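(* Let $(N_t)_{t\ge0}$ be a Lévy process in $\mathbb R^n$ with $N_0=0$ a.s. and $\mathbb E\left(\sup_{t\in[0,T]}|N_t|^2\right)<+\infty$ for every $T>0$. Let $U:\mathbb R^n\to\mathbb R$ be a $C^2$ function such that $\nabla U$ is Lipschitz, and for $x\in\mathbb R^n$ let $(X_t^x)_{t\ge0}$ be the unique solution of $$dX_t^x=-\nabla U(X_t^x)\,dt+dN_t,\qquad X_0^x=x.$$ Let $P_tf(x)=\mathbb E(f(X_t^x))$. Assume that there exists $a>0$ such that $\nabla^2U\ge a$ uniformly in the sense of quadratic forms. Then there exists a unique probability measure $\mu\in\mathcal P_2(\mathbb R^n)$ such that $\mu P_t=\mu$ for every $t\ge0$. Moreover, for every $t\ge0$ and $\nu\in\mathcal P_2(\mathbb R^n)$, $$W_2(\nu P_t,\mu)^2\le e^{-2at}\,W_2(\nu,\mu)^2.$$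
   Context: A Lévy process is a càdlàg stochastic process with stationary and independent increments. $\nabla^2U$ is the Hessian of $U$. $P_t$ is viewed as the Markov kernel $P_t(x,A)=\mathbb P(X_t^x\in A)$ and $\nu P_t(A)=\int P_t(x,A)\,\nu(dx)$. $\mathcal P_2(\mathbb R^n)$ is the set of Borel probability measures with finite second moment, and $W_2(\mu_0,\mu_1)^2=\inf_\pi\int|x_0-x_1|^2\,\pi(dx_0,dx_1)$, the infimum over couplings $\pi$ of $\mu_0,\mu_1$ (Euclidean distance). *)

theory Defs
  imports "HOL-Probability.Probability"
begin

definition cadlag :: "(real \<Rightarrow> 'a::topological_space) \<Rightarrow> bool" where
  "cadlag f \<longleftrightarrow>
     (\<forall>t\<ge>0. continuous (at_right t) f) \<and>
     (\<forall>t>0. \<exists>l. (f \<longlongrightarrow> l) (at_left t))"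

text \<open>
  The time index is real; only times \<open>t \<ge> 0\<close> matter.  \<open>N\<^sub>0 = 0\<close> is not part of the notion.
\<close>

definition levy_process :: "'w measure \<Rightarrow> (real \<Rightarrow> 'w \<Rightarrow> real ^ 'n) \<Rightarrow> bool" where
  "levy_process M N \<longleftrightarrow>
     prob_space M \<and>
     (\<forall>t\<ge>0. N t \<in> borel_measurable M) \<and>
     (\<forall>\<omega>\<in>space M. cadlag (\<lambda>t. N t \<omega>)) \<and>
     (\<forall>s\<ge>0. \<forall>h\<ge>0. distr M borel (\<lambda>\<omega>. N (s + h) \<omega> - N s \<omega>)
                    = distr M borel (\<lambda>\<omega>. N h \<omega> - N 0 \<omega>)) \<and>
     (\<forall>k::nat. \<forall>\<tau>::nat \<Rightarrow> real. 0 \<le> \<tau> 0 \<and> (\<forall>i<k. \<tau> i < \<tau> (Suc i)) \<longrightarrow>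
        prob_space.indep_vars M (\<lambda>_. borel) (\<lambda>i \<omega>. N (\<tau> (Suc i)) \<omega> - N (\<tau> i) \<omega>) {..<k})"

definition grad :: "(real ^ 'n \<Rightarrow> real) \<Rightarrow> real ^ 'n \<Rightarrow> real ^ 'n" where
  "grad U x = (\<chi> i. frechet_derivative U (at x) (axis i 1))"

definition hessian :: "(real ^ 'n \<Rightarrow> real) \<Rightarrow> real ^ 'n \<Rightarrow> real ^ 'n ^ 'n" where
  "hessian U x = jacobian (grad U) (at x)"

definition C2 :: "(real ^ 'n \<Rightarrow> real) \<Rightarrow> bool" where
  "C2 U \<longleftrightarrow> (\<forall>x. U differentiable (at x)) \<and> (\<forall>x. grad U differentiable (at x)) \<and>
     continuous_on UNIV (hessian U)"

text \<open>
  \<open>Y\<close> solves \<open>dY = - \<nabla>U(Y) dt + dN\<close>, \<open>Y\<^sub>0 = x\<close>.  The noise is additive, so the equation is the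
  pathwise integral equation, required to hold for all times simultaneously outside a null set.
\<close>

definition sde_solution ::
  "'w measure \<Rightarrow> (real \<Rightarrow> 'w \<Rightarrow> real ^ 'n) \<Rightarrow> (real ^ 'n \<Rightarrow> real) \<Rightarrow> real ^ 'n \<Rightarrow>
   (real \<Rightarrow> 'w \<Rightarrow> real ^ 'n) \<Rightarrow> bool" where
  "sde_solution M N U x Y \<longleftrightarrow>
     (\<forall>t\<ge>0. Y t \<in> borel_measurable M) \<and>
     (AE \<omega> in M. Y 0 \<omega> = x \<and>
        (\<forall>t\<ge>0. set_integrable lborel {0..t} (\<lambda>s. grad U (Y s \<omega>)) \<and>
          Y t \<omega> = Y 0 \<omega> - (LINT s:{0..t}|lborel. grad U (Y s \<omega>)) + (N t \<omega> - N 0 \<omega>)))"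

definition transition_kernel ::
  "'w measure \<Rightarrow> (real ^ 'n \<Rightarrow> real \<Rightarrow> 'w \<Rightarrow> real ^ 'n) \<Rightarrow> real \<Rightarrow> real ^ 'n \<Rightarrow>
   (real ^ 'n) measure" where
  "transition_kernel M X t x = distr M borel (X x t)"

text \<open>
  \<open>(\<nu>P\<^sub>t)(A) = \<integral> P\<^sub>t(x, A) \<nu>(dx)\<close> is the bind of the Giry monad, see \<open>emeasure_bind\<close>.
\<close>

definition push_kernel ::
  "'w measure \<Rightarrow> (real ^ 'n \<Rightarrow> real \<Rightarrow> 'w \<Rightarrow> real ^ 'n) \<Rightarrow> (real ^ 'n) measure \<Rightarrow> real \<Rightarrow>
   (real ^ 'n) measure" where
  "push_kernel M X \<nu> t = Giry_Monad.bind \<nu> (transition_kernel M X t)"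

definition P2 :: "(real ^ 'n) measure set" where
  "P2 = {\<mu>. sets \<mu> = sets borel \<and> prob_space \<mu> \<and> (\<integral>\<^sup>+x. ennreal ((norm x)\<^sup>2) \<partial>\<mu>) < \<infinity>}"

definition couplings ::
  "(real ^ 'n) measure \<Rightarrow> (real ^ 'n) measure \<Rightarrow> ((real ^ 'n) \<times> (real ^ 'n)) measure set" where
  "couplings \<mu>0 \<mu>1 = {\<pi>. sets \<pi> = sets (borel \<Otimes>\<^sub>M borel) \<and>
     distr \<pi> borel fst = \<mu>0 \<and> distr \<pi> borel snd = \<mu>1}"

text \<open>The square \<open>W\<^sub>2(\<mu>\<^sub>0, \<mu>\<^sub>1)\<^sup>2\<close> of the Wasserstein distance, with values in \<open>[0, \<infinity>]\<close>.\<close>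

definition W2_squared :: "(real ^ 'n) measure \<Rightarrow> (real ^ 'n) measure \<Rightarrow> ennreal" where
  "W2_squared \<mu>0 \<mu>1 =
     (INF \<pi>\<in>couplings \<mu>0 \<mu>1. \<integral>\<^sup>+z. ennreal ((dist (fst z) (snd z))\<^sup>2) \<partial>\<pi>)"

end

theory Submission
  imports Defs
begin

text \<open>
  The noise is additive, so two solutions driven by the same noise path differ by a function whose
  derivative is the difference of the drifts, and \<open>\<nabla>\<^sup>2U \<ge> a\<close> pulls them together:
  \<open>|X\<^sub>t\<^sup>x - X\<^sub>t\<^sup>y| \<le> exp (- a t) |x - y|\<close> almost surely. For fixed \<open>t\<close> the map \<open>x \<mapsto> X\<^sub>t\<^sup>x\<close> is thus a random map
  with Lipschitz constant \<open>q = exp (- a t)\<close>, and both claims rest on this.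

  \<^item> Sending both coordinates of a coupling of \<open>\<nu>\<close> and \<open>\<mu>\<close> through the same realisation of the map
    gives a coupling of \<open>\<nu>P\<^sub>t\<close> and \<open>\<mu>P\<^sub>t\<close> whose cost is at most \<open>q\<^sup>2\<close>
    times the original one (\<open>coupling_push\<close>).
  \<^item> For \<open>t = 1\<close>, compose independent copies of the map backwards in time:
    \<open>Y\<^sub>k = \<phi>\<^sub>0 \<circ> \<dots> \<circ> \<phi>\<^sub>k\<^sub>-\<^sub>1 (0)\<close>. The difference of consecutive terms has a mean square of order \<open>q\<^sup>2\<^sup>k\<close>, so \<open>Y\<^sub>k\<close>
    converges almost surely, and the law of the limit is invariant under \<open>P\<^sub>1\<close> and has a second moment
    (\<open>fixed_point_exists\<close>). It is the only invariant law, because the iterates \<open>P\<^sub>1\<^sup>k f\<close> of a bounded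
    Lipschitz function become constant (\<open>fixed_point_unique\<close>).
  \<^item> If \<open>\<mu>P\<^sub>1 = \<mu>\<close>, then \<open>(\<mu>P\<^sub>t)P\<^sub>1 = (\<mu>P\<^sub>1)P\<^sub>t = \<mu>P\<^sub>t\<close>, and uniqueness for \<open>P\<^sub>1\<close> gives \<open>\<mu>P\<^sub>t = \<mu>\<close> for every \<open>t\<close>.

  The last step needs \<open>P\<^sub>s P\<^sub>t = P\<^sub>s\<^sub>+\<^sub>t\<close> (\<open>semigroup\<close>), which is where the stationary independent
  increments enter. To use them, the solution is approximated by a scheme that depends on finitely
  many increments: in a step of length \<open>h\<close> add the increment of the noise, then apply
  \<open>z \<mapsto> z - h \<nabla>U z\<close>. It converges along each path (\<open>splitting_tendsto\<close>), it is a composition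
  of identically distributed independent steps, and it also yields the other facts about the
  solution that are needed: each step is a contraction up to an error of order \<open>h\<^sup>2\<close>, which gives the
  estimate above; it grows at most linearly with the size of the noise, which gives the second
  moment of \<open>X\<^sub>1\<^sup>0\<close>; and it is jointly measurable in \<open>(x, \<omega>)\<close>, so its limit is a jointly measurable
  version of \<open>X\<^sub>t\<^sup>x\<close>.
\<close>

section \<open>Solutions driven by a fixed cadlag path\<close>

text \<open>
  The right value and the left limit bound the path on a neighbourhood of each time, and finitely
  many of these neighbourhoods cover the compact interval.
\<close>
lemma cadlag_bounded:
  fixes w :: "real \<Rightarrow> 'b::real_normed_vector"
  assumes "cadlag w"
  shows "bounded (w ` {0..T})"
proof -
  have loc: "\<exists>S. open S \<and> t \<in> S \<and> bounded (w ` (S \<inter> {0..T}))" if t: "t \<in> {0..T}" for t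
  proof -
    from assms t have "(w \<longlongrightarrow> w t) (at_right t)"
      by (auto simp: cadlag_def continuous_within)
    then have "\<forall>\<^sub>F r in at_right t. dist (w r) (w t) < 1"
      by (rule tendstoD) simp
    then obtain b where b: "b > t" "\<And>r. t < r \<Longrightarrow> r < b \<Longrightarrow> dist (w r) (w t) < 1"
      unfolding eventually_at_right_field by blast
    obtain c B where c: "c < t" "\<And>r. c < r \<Longrightarrow> r < t \<Longrightarrow> r \<ge> 0 \<Longrightarrow> norm (w r) \<le> B"
    proof (cases "t = 0")
      case True
      then show ?thesis by (intro that[of "-1" 0]) auto
    next
      case False
      with t assms obtain l where "(w \<longlongrightarrow> l) (at_left t)"
        by (force simp: cadlag_def)
      then have "\<forall>\<^sub>F r in at_left t. dist (w r) l < 1"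
        by (rule tendstoD) simp
      then obtain c where c: "c < t" "\<And>r. c < r \<Longrightarrow> r < t \<Longrightarrow> dist (w r) l < 1"
        unfolding eventually_at_left_field by blast
      have "norm (w r) \<le> norm l + 1" if "c < r" "r < t" for r
        using c(2)[OF that] norm_triangle_sub[of "w r" l] by (simp add: dist_norm)
      with c(1) show ?thesis by (intro that) auto
    qed
    have "norm (w r) \<le> max B (norm (w t) + 1)" if "c < r" "r < b" "0 \<le> r" for r
    proof -
      consider "r < t" | "r = t" | "t < r" by linarith
      then show ?thesis
      proof cases
        case 1 then show ?thesis using c(2) that by (simp add: le_max_iff_disj)
      next
        case 2 then show ?thesis by simp
      next
        case 3 then show ?thesis
          using b(2)[of r] that norm_triangle_sub[of "w r" "w t"]
          by (simp add: dist_norm le_max_iff_disj)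
      qed
    qed
    then have "bounded (w ` ({c<..<b} \<inter> {0..T}))"
      unfolding bounded_iff by (intro exI[of _ "max B (norm (w t) + 1)"]) auto
    then show ?thesis using b c by (intro exI[of _ "{c<..<b}"]) auto
  qed
  then have "\<forall>t\<in>{0..T}. \<exists>S. open S \<and> t \<in> S \<and> bounded (w ` (S \<inter> {0..T}))"
    by blast
  from bchoice[OF this] obtain S where
    S: "\<And>t. t \<in> {0..T} \<Longrightarrow> open (S t) \<and> t \<in> S t \<and> bounded (w ` (S t \<inter> {0..T}))"
    by blast
  obtain C where C: "C \<subseteq> {0..T}" "finite C" "{0..T} \<subseteq> (\<Union>c\<in>C. S c)"
  proof (rule compactE_image[OF compact_Icc])
    show "open (S t)" if "t \<in> {0..T}" for t using S[OF that] by simp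
    show "{0..T} \<subseteq> (\<Union>c\<in>{0..T}. S c)" using S by blast
  qed
  have "bounded (w ` (S c \<inter> {0..T}))" if "c \<in> C" for c
    using S[of c] C(1) that by blast
  with C(2) have "bounded (\<Union>c\<in>C. w ` (S c \<inter> {0..T}))"
    by (simp add: bounded_UN)
  then show ?thesis
  proof (rule bounded_subset)
    show "w ` {0..T} \<subseteq> (\<Union>c\<in>C. w ` (S c \<inter> {0..T}))"
    proof (rule image_subsetI)
      fix t assume "t \<in> {0..T}"
      with C(3) obtain c where "c \<in> C" "t \<in> S c" by (meson UN_E subsetD)
      with \<open>t \<in> {0..T}\<close> show "w t \<in> (\<Union>c\<in>C. w ` (S c \<inter> {0..T}))" by blast
    qed
  qed
qed

definition path_solution :: "('b::euclidean_space \<Rightarrow> 'b) \<Rightarrow> (real \<Rightarrow> 'b) \<Rightarrow> (real \<Rightarrow> 'b) \<Rightarrow> bool" where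
  "path_solution g w y \<longleftrightarrow>
     (\<forall>t\<ge>0. set_integrable lborel {0..t} (\<lambda>s. g (y s)) \<and>
        y t = y 0 - (LINT s:{0..t}|lborel. g (y s)) + (w t - w 0))"

lemma path_solutionD:
  assumes "path_solution g w y" "0 \<le> t"
  shows "set_integrable lborel {0..t} (\<lambda>s. g (y s))"
    and "y t = y 0 - (LINT s:{0..t}|lborel. g (y s)) + (w t - w 0)"
  using assms unfolding path_solution_def by blast+

text \<open>
  The equation presupposes that the drift is integrable along the solution. The integral of its norm
  over \<open>[0, T]\<close> therefore bounds the drift part, and \<open>cadlag_bounded\<close> bounds the noise part.
\<close>
lemma path_solution_bounded:
  assumes "path_solution g w y" "cadlag w"
  shows "bounded (y ` {0..T})"
proof -
  obtain B where B: "\<And>t. t \<in> {0..T} \<Longrightarrow> norm (w t) \<le> B"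
    using cadlag_bounded[OF assms(2), of T] unfolding bounded_iff by blast
  define K where "K = (LINT s:{0..T}|lborel. norm (g (y s)))"
  have "norm (y t) \<le> norm (y 0) + K + (B + norm (w 0))" if t: "t \<in> {0..T}" for t
  proof -
    have "0 \<le> t" "0 \<le> T" using t by auto
    note i = path_solutionD(1)[OF assms(1) this(1)] path_solutionD(1)[OF assms(1) this(2)]
      and y = path_solutionD(2)[OF assms(1) this(1)]
    have "norm (LINT s:{0..t}|lborel. g (y s)) \<le> (LINT s:{0..t}|lborel. norm (g (y s)))"
      by (rule set_integral_norm_bound[OF i(1)])
    also have "\<dots> \<le> K"
      unfolding K_def set_lebesgue_integral_def
      using set_integrable_norm[OF i(1)] set_integrable_norm[OF i(2)] t
      by (intro integral_mono) (auto simp: set_integrable_def indicator_def)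
    finally have 1: "norm (LINT s:{0..t}|lborel. g (y s)) \<le> K" .
    have "norm (y t) \<le> norm (y 0) + norm (LINT s:{0..t}|lborel. g (y s)) + (norm (w t) + norm (w 0))"
      by (subst y, intro order.trans[OF norm_triangle_ineq] add_mono norm_triangle_ineq4)
    then show ?thesis using 1 B[OF t] by simp
  qed
  then show ?thesis unfolding bounded_iff by blast
qed

lemma path_solution_increment:
  assumes "path_solution g w y" "0 \<le> u" "u \<le> v"
  shows "set_integrable lborel {u<..v} (\<lambda>s. g (y s))"
    and "y v = y u - (LINT s:{u<..v}|lborel. g (y s)) + (w v - w u)"
proof -
  have "0 \<le> v" using assms(2,3) by simp
  note i = path_solutionD(1)[OF assms(1,2)] path_solutionD(1)[OF assms(1) this]
    and y = path_solutionD(2)[OF assms(1,2)] path_solutionD(2)[OF assms(1) this]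
  show 1: "set_integrable lborel {u<..v} (\<lambda>s. g (y s))"
    by (rule set_integrable_subset[OF i(2)]) (use assms in auto)
  have "{0..v} = {0..u} \<union> {u<..v}" using assms by auto
  then have "(LINT s:{0..v}|lborel. g (y s)) =
      (LINT s:{0..u}|lborel. g (y s)) + (LINT s:{u<..v}|lborel. g (y s))"
    using i 1 by (simp add: set_integral_Un Int_def)
  then show "y v = y u - (LINT s:{u<..v}|lborel. g (y s)) + (w v - w u)"
    by (subst y(1), subst y(2)) simp
qed

lemma lipschitz_bounded_image:
  fixes g :: "'a::heine_borel \<Rightarrow> 'b::heine_borel"
  assumes "L-lipschitz_on UNIV g" "bounded S"
  shows "bounded (g ` S)"
  by (rule bounded_uniformly_continuous_image
      [OF lipschitz_on_uniformly_continuous[OF lipschitz_on_subset[OF assms(1) subset_UNIV]] assms(2)])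

lemma set_integrable_const_Ioc: "set_integrable lborel {u<..v::real} (\<lambda>_. C::real)"
  unfolding set_integrable_def
  by (cases "u \<le> v") (auto intro!: integrable_real_indicator simp: emeasure_lborel_Ioc)

lemma norm_set_integral_le_const:
  fixes f :: "real \<Rightarrow> 'b::euclidean_space"
  assumes "set_integrable lborel {u<..v} f" "u \<le> v" "\<And>r. r \<in> {u<..v} \<Longrightarrow> norm (f r) \<le> C"
  shows "norm (LINT r:{u<..v}|lborel. f r) \<le> C * (v - u)"
proof -
  have "norm (LINT r:{u<..v}|lborel. f r) \<le> (LINT r:{u<..v}|lborel. norm (f r))"
    by (rule set_integral_norm_bound[OF assms(1)])
  also have "\<dots> \<le> (LINT r:{u<..v}|lborel. C)"
    using assms by (intro set_integral_mono set_integrable_norm) (auto intro!: set_integrable_const_Ioc)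
  also have "\<dots> = C * (v - u)"
    using assms(2) by (simp add: set_lebesgue_integral_def mult.commute)
  finally show ?thesis .
qed

lemma path_solution_right_continuous:
  assumes "path_solution g w y" "cadlag w" "L-lipschitz_on UNIV g" "0 \<le> t"
  shows "continuous (at_right t) y"
proof -
  have "bounded ((\<lambda>r. g (y r)) ` {0..t+1})"
    using lipschitz_bounded_image[OF assms(3) path_solution_bounded[OF assms(1,2)], of "t+1"]
    by (simp add: image_image)
  then obtain C where C: "\<And>r. r \<in> {0..t+1} \<Longrightarrow> norm (g (y r)) \<le> C"
    unfolding bounded_iff by blast
  have w: "(w \<longlongrightarrow> w t) (at_right t)"
    using assms by (auto simp: cadlag_def continuous_within)
  have I: "((\<lambda>v. LINT r:{t<..v}|lborel. g (y r)) \<longlongrightarrow> 0) (at_right t)"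
  proof (rule Lim_null_comparison)
    show "((\<lambda>v. C * (v - t)) \<longlongrightarrow> 0) (at_right t)"
      by (auto intro!: tendsto_eq_intros)
    have "\<forall>\<^sub>F v in at_right t. v \<in> {t<..<t+1}"
      by (rule eventually_at_right_real) simp
    then show "\<forall>\<^sub>F v in at_right t. norm (LINT r:{t<..v}|lborel. g (y r)) \<le> C * (v - t)"
      by eventually_elim
        (use assms C in \<open>intro norm_set_integral_le_const path_solution_increment(1), auto\<close>)
  qed
  have "((\<lambda>v. y t - (LINT r:{t<..v}|lborel. g (y r)) + (w v - w t)) \<longlongrightarrow> y t - 0 + (w t - w t)) (at_right t)"
    by (intro tendsto_intros w I)
  moreover have "\<forall>\<^sub>F v in at_right t. y t - (LINT r:{t<..v}|lborel. g (y r)) + (w v - w t) = y v"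
    unfolding eventually_at_filter
    by (rule always_eventually) (metis path_solution_increment(2)[OF assms(1,4)] greaterThan_iff less_imp_le)
  ultimately show ?thesis
    unfolding continuous_within by (simp add: tendsto_cong)
qed

section \<open>Convergence of the splitting scheme\<close>

text \<open>
  One step first adds the noise increment \<open>d j\<close> and then follows the drift for the time \<open>h j\<close>. In this
  order the drift is evaluated close to the value of the solution at the right end of the step. As
  right ends approach a time from the right, the comparison with the solution uses its
  right-continuity only, and jumps do no harm.
\<close>
primrec splitting :: "('b::real_vector \<Rightarrow> 'b) \<Rightarrow> (nat \<Rightarrow> real) \<Rightarrow> (nat \<Rightarrow> 'b) \<Rightarrow> 'b \<Rightarrow> nat \<Rightarrow> 'b" where
  "splitting g h d x 0 = x"
| "splitting g h d x (Suc j) =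
     splitting g h d x j + d j - h j *\<^sub>R g (splitting g h d x j + d j)"

lemma splitting_cong:
  assumes "\<And>i. i < j \<Longrightarrow> h i = h' i" "\<And>i. i < j \<Longrightarrow> d i = d' i"
  shows "splitting g h d x j = splitting g h' d' x j"
  using assms by (induction j) auto

lemma splitting_add:
  "splitting g h d x (m + i) = splitting g (\<lambda>i. h (m + i)) (\<lambda>i. d (m + i)) (splitting g h d x m) i"
  by (induction i) auto

definition grid :: "real \<Rightarrow> real \<Rightarrow> nat \<Rightarrow> real" where
  "grid s h j = s + real j * h"

definition increments :: "(real \<Rightarrow> 'b::minus) \<Rightarrow> (nat \<Rightarrow> real) \<Rightarrow> nat \<Rightarrow> 'b" where
  "increments w \<tau> j = w (\<tau> (Suc j)) - w (\<tau> j)"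

text \<open>The right end of the cell of the grid with origin \<open>s\<close> and mesh \<open>h\<close> that contains \<open>r\<close>.\<close>
definition grid_ceiling :: "real \<Rightarrow> real \<Rightarrow> real \<Rightarrow> real" where
  "grid_ceiling s h r = s + h * of_int \<lceil>(r - s) / h\<rceil>"

lemma grid_ceiling_eq:
  assumes "h > 0" "r \<in> {grid s h j<..grid s h (Suc j)}"
  shows "grid_ceiling s h r = grid s h (Suc j)"
proof -
  have "\<lceil>(r - s) / h\<rceil> = int (Suc j)"
    using assms by (intro ceiling_unique) (auto simp: grid_def field_simps)
  then show ?thesis by (simp add: grid_ceiling_def grid_def algebra_simps)
qed

lemma grid_ceiling_bounds:
  assumes "h > 0"
  shows "r \<le> grid_ceiling s h r" "grid_ceiling s h r < r + h"
proof -
  define c where "c = of_int \<lceil>(r - s) / h\<rceil> - (r - s) / h"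
  have c: "0 \<le> c" "c < 1" unfolding c_def by linarith+
  have "grid_ceiling s h r = r + h * c"
    using assms by (simp add: grid_ceiling_def c_def field_simps)
  with c assms show "r \<le> grid_ceiling s h r" "grid_ceiling s h r < r + h" by simp_all
qed

text \<open>
  A discrete Gronwall estimate. The noise increments of the scheme and of the solution cancel, so a
  step multiplies the error by \<open>1 + L * h\<close> and adds two terms: the oscillation \<open>\<delta>\<close> of the drift
  between a time and the right end of its cell, and the effect \<open>L * C * h\<^sup>2\<close> of the scheme ignoring
  the drift accumulated within the cell.
\<close>
lemma splitting_error:
  assumes sol: "path_solution g w y" and g: "L-lipschitz_on UNIV g"
    and s: "0 \<le> s" and h: "0 < h"
    and C: "\<And>r. r \<in> {s..grid s h k} \<Longrightarrow> norm (g (y r)) \<le> C"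
    and \<delta>: "\<delta> = (\<lambda>r. norm (g (y r) - g (y (grid_ceiling s h r))))"
    and \<delta>_int: "set_integrable lborel {s<..grid s h k} \<delta>"
    and j: "j \<le> k"
  shows "norm (y (grid s h j) - splitting g (\<lambda>_. h) (increments w (grid s h)) z j)
    \<le> (1 + L * h) ^ j * (norm (y s - z) + (LINT r:{s<..grid s h j}|lborel. \<delta> r) + real j * (L * C * h\<^sup>2))"
  using j
proof (induction j)
  case 0
  then show ?case by (simp add: grid_def set_lebesgue_integral_def)
next
  case (Suc j)
  have L: "0 \<le> L" using g by (rule lipschitz_on_nonneg)
  define E where "E = splitting g (\<lambda>_. h) (increments w (grid s h)) z j"
  define u v where "u = grid s h j" and "v = grid s h (Suc j)"
  have uv: "s \<le> u" "u \<le> v" "v - u = h" "v \<le> grid s h k"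
    using h Suc.prems mult_right_mono[of "1 + real j" "real k" h]
    by (auto simp: u_def v_def grid_def algebra_simps)
  have C0: "0 \<le> C" using norm_ge_zero C[of s] uv by (meson atLeastAtMost_iff order.trans order_refl)
  define d where "d = w v - w u"
  have int: "set_integrable lborel {u<..v} (\<lambda>r. g (y r))"
    using path_solution_increment(1)[OF sol, of u v] s uv by simp
  have yv: "y v = y u - (LINT r:{u<..v}|lborel. g (y r)) + d"
    unfolding d_def using path_solution_increment(2)[OF sol, of u v] s uv by simp
  have cst: "set_integrable lborel {u<..v} (\<lambda>r. g (E + d))"
    using integrable_scaleR_left[OF set_integrable_const_Ioc[of u v 1, unfolded set_integrable_def], of "g (E + d)"]
    by (simp add: set_integrable_def)
  have hE: "(LINT r:{u<..v}|lborel. g (E + d)) = h *\<^sub>R g (E + d)"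
    using uv by (simp add: set_lebesgue_integral_def)
  have "splitting g (\<lambda>_. h) (increments w (grid s h)) z (Suc j) = E + d - h *\<^sub>R g (E + d)"
    by (simp add: E_def d_def increments_def u_def v_def)
  then have "y v - splitting g (\<lambda>_. h) (increments w (grid s h)) z (Suc j)
      = (y u - E) - (LINT r:{u<..v}|lborel. g (y r) - g (E + d))"
    using int cst hE by (simp add: set_integral_diff yv)
  also have "norm \<dots> \<le> norm (y u - E) + norm (LINT r:{u<..v}|lborel. g (y r) - g (E + d))"
    by (rule norm_triangle_ineq4)
  also have "norm (LINT r:{u<..v}|lborel. g (y r) - g (E + d))
      \<le> (LINT r:{u<..v}|lborel. norm (g (y r) - g (E + d)))"
    by (rule set_integral_norm_bound) (intro set_integral_diff int cst)
  also have "\<dots> \<le> (LINT r:{u<..v}|lborel. \<delta> r + L * (norm (y u - E) + C * h))"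
  proof (rule set_integral_mono)
    have \<delta>': "set_integrable lborel {u<..v} \<delta>"
      by (rule set_integrable_subset[OF \<delta>_int]) (use uv in auto)
    show "set_integrable lborel {u<..v} (\<lambda>r. norm (g (y r) - g (E + d)))"
      by (intro set_integrable_norm set_integral_diff int cst)
    show "set_integrable lborel {u<..v} (\<lambda>r. \<delta> r + L * (norm (y u - E) + C * h))"
      by (intro set_integral_add \<delta>' set_integrable_const_Ioc)
    fix r assume r: "r \<in> {u<..v}"
    have "norm (y v - (E + d)) = norm ((y u - E) - (LINT r:{u<..v}|lborel. g (y r)))"
      by (simp add: yv algebra_simps)
    also have "\<dots> \<le> norm (y u - E) + norm (LINT r:{u<..v}|lborel. g (y r))"
      by (rule norm_triangle_ineq4)
    also have "norm (LINT r:{u<..v}|lborel. g (y r)) \<le> C * (v - u)"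
      using int uv C by (intro norm_set_integral_le_const) auto
    finally have "norm (y v - (E + d)) \<le> norm (y u - E) + C * h" using uv by simp
    then have "L * norm (y v - (E + d)) \<le> L * (norm (y u - E) + C * h)"
      using L by (rule mult_left_mono)
    moreover have "norm (g (y v) - g (E + d)) \<le> L * norm (y v - (E + d))"
      using lipschitz_onD[OF g, of "y v" "E + d"] by (simp add: dist_norm)
    moreover have "\<delta> r = norm (g (y r) - g (y v))"
      unfolding \<delta> using grid_ceiling_eq[OF h, of r s j] r by (simp add: u_def v_def)
    moreover have "norm (g (y r) - g (E + d)) \<le> norm (g (y r) - g (y v)) + norm (g (y v) - g (E + d))"
      by (rule norm_diff_triangle_le[OF order_refl order_refl])
    ultimately show "norm (g (y r) - g (E + d)) \<le> \<delta> r + L * (norm (y u - E) + C * h)"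
      by linarith
  qed
  also have "\<dots> = (LINT r:{u<..v}|lborel. \<delta> r) + L * (norm (y u - E) + C * h) * h"
  proof -
    have \<delta>': "set_integrable lborel {u<..v} \<delta>"
      by (rule set_integrable_subset[OF \<delta>_int]) (use uv in auto)
    have "(LINT r:{u<..v}|lborel. L * (norm (y u - E) + C * h)) = L * (norm (y u - E) + C * h) * h"
      using uv by (simp add: set_lebesgue_integral_def)
    then show ?thesis
      by (subst set_integral_add(2)[OF \<delta>' set_integrable_const_Ioc]) simp
  qed
  finally have step: "norm (y v - splitting g (\<lambda>_. h) (increments w (grid s h)) z (Suc j))
      \<le> (1 + L * h) * norm (y u - E) + ((LINT r:{u<..v}|lborel. \<delta> r) + L * C * h\<^sup>2)"
    by (simp add: algebra_simps power2_eq_square)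
  have \<delta>_nonneg: "0 \<le> (LINT r:{u<..v}|lborel. \<delta> r)"
    unfolding set_lebesgue_integral_def \<delta> by (intro integral_nonneg_AE) auto
  have sum: "(LINT r:{s<..v}|lborel. \<delta> r) = (LINT r:{s<..u}|lborel. \<delta> r) + (LINT r:{u<..v}|lborel. \<delta> r)"
  proof -
    have "{s<..v} = {s<..u} \<union> {u<..v}" using uv by auto
    then show ?thesis
      by (simp only:) (intro set_integral_Un set_integrable_subset[OF \<delta>_int]; use uv in auto)
  qed
  have one: "1 \<le> (1 + L * h) ^ Suc j" using L h by (intro one_le_power) simp
  have m1: "(1 + L * h) * norm (y u - E) \<le> (1 + L * h) *
      ((1 + L * h) ^ j * (norm (y s - z) + (LINT r:{s<..u}|lborel. \<delta> r) + real j * (L * C * h\<^sup>2)))"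
    using Suc L h unfolding E_def u_def by (intro mult_left_mono) auto
  have m2: "1 * ((LINT r:{u<..v}|lborel. \<delta> r) + L * C * h\<^sup>2)
      \<le> (1 + L * h) ^ Suc j * ((LINT r:{u<..v}|lborel. \<delta> r) + L * C * h\<^sup>2)"
    using one \<delta>_nonneg L C0 by (intro mult_right_mono) auto
  have "norm (y v - splitting g (\<lambda>_. h) (increments w (grid s h)) z (Suc j))
      \<le> (1 + L * h) * ((1 + L * h) ^ j * (norm (y s - z) + (LINT r:{s<..u}|lborel. \<delta> r) + real j * (L * C * h\<^sup>2)))
        + (1 + L * h) ^ Suc j * ((LINT r:{u<..v}|lborel. \<delta> r) + L * C * h\<^sup>2)"
    by (rule order.trans[OF step add_mono[OF m1 m2[unfolded mult_1]]])
  also have "\<dots> = (1 + L * h) ^ Suc j *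
      (norm (y s - z) + (LINT r:{s<..v}|lborel. \<delta> r) + real (Suc j) * (L * C * h\<^sup>2))"
    unfolding sum by (simp add: algebra_simps)
  finally show ?case unfolding v_def .
qed

lemma grid_end: "k > 0 \<Longrightarrow> grid s (t / real k) k = s + t"
  by (simp add: grid_def)

lemma power_one_plus_le_exp:
  fixes x :: real
  assumes "0 \<le> x" "k > 0"
  shows "(1 + x / real k) ^ k \<le> exp x"
proof -
  have "(1 + x / real k) ^ k \<le> exp (x / real k) ^ k"
    using assms by (intro power_mono exp_ge_add_one_self) auto
  also have "\<dots> = exp x" using assms by (simp flip: exp_of_nat_mult)
  finally show ?thesis .
qed

lemma measurable_grid_ceiling_compose:
  fixes f :: "real \<Rightarrow> 'c::topological_space"
  shows "(\<lambda>r. f (grid_ceiling s h r)) \<in> borel_measurable borel"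
proof -
  have "(\<lambda>r. (\<lambda>i::int. f (s + h * of_int i)) \<lceil>(r - s) / h\<rceil>) \<in> borel_measurable borel"
    by (rule measurable_compose[where N="count_space UNIV"]) measurable
  then show ?thesis by (simp add: grid_ceiling_def)
qed

text \<open>
  As the mesh shrinks, the right end of the cell of \<open>r\<close> approaches \<open>r\<close> from the right, so the
  oscillation in the preceding estimate tends to zero pointwise by right-continuity of \<open>y\<close>, and its
  integral by dominated convergence. The starting points \<open>z k\<close> may vary so that the scheme can be
  restarted at time \<open>s\<close> from its own output.
\<close>
lemma splitting_tendsto:
  assumes sol: "path_solution g w y" and w: "cadlag w" and g: "L-lipschitz_on UNIV g"
    and s: "0 \<le> s" and t: "0 < t" and z: "z \<longlonglongrightarrow> y s"
  shows "(\<lambda>k. splitting g (\<lambda>_. t / real k) (increments w (grid s (t / real k))) (z k) k)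
    \<longlonglongrightarrow> y (s + t)"
proof -
  have L: "0 \<le> L" using g by (rule lipschitz_on_nonneg)
  have "bounded ((\<lambda>r. g (y r)) ` {0..s+t+t})"
    using lipschitz_bounded_image[OF g path_solution_bounded[OF sol w], of "s+t+t"]
    by (simp add: image_image)
  then obtain C where C: "\<And>r. r \<in> {0..s+t+t} \<Longrightarrow> norm (g (y r)) \<le> C"
    unfolding bounded_iff by blast
  define \<delta> where "\<delta> k = (\<lambda>r. norm (g (y r) - g (y (grid_ceiling s (t / real k) r))))" for k
  have gy: "set_integrable lborel {s<..s+t} (\<lambda>r. g (y r))"
    using path_solution_increment(1)[OF sol s, of "s+t"] t by simp
  have \<delta>_meas: "(\<lambda>r. indicator {s<..s+t} r *\<^sub>R \<delta> k r) \<in> borel_measurable lborel" for k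
  proof -
    have [measurable]: "(\<lambda>r. indicator {s<..s+t} r *\<^sub>R g (y r)) \<in> borel_measurable borel"
      using gy unfolding set_integrable_def by (simp add: borel_measurable_integrable)
    note [measurable] = measurable_grid_ceiling_compose[of "\<lambda>r. g (y r)"]
    have "(\<lambda>r. norm (indicator {s<..s+t} r *\<^sub>R g (y r)
          - indicator {s<..s+t} r *\<^sub>R g (y (grid_ceiling s (t / real k) r)))) \<in> borel_measurable borel"
      by measurable
    also have "(\<lambda>r. norm (indicator {s<..s+t} r *\<^sub>R g (y r)
          - indicator {s<..s+t} r *\<^sub>R g (y (grid_ceiling s (t / real k) r))))
        = (\<lambda>r. indicator {s<..s+t} r *\<^sub>R \<delta> k r)"
      by (auto simp: \<delta>_def indicator_def)
    finally show ?thesis by simp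
  qed
  have \<delta>_bound: "\<bar>\<delta> k r\<bar> \<le> 2 * C" if "r \<in> {s<..s+t}" "k > 0" for k r
  proof -
    have "t / real k \<le> t" using t that(2) by (simp add: divide_le_eq)
    then have "grid_ceiling s (t / real k) r \<in> {0..s+t+t}"
      using grid_ceiling_bounds[where h="t / real k" and r=r and s=s] t s that by auto
    then have "norm (g (y (grid_ceiling s (t / real k) r))) \<le> C" by (rule C)
    moreover have "norm (g (y r)) \<le> C" using that s t by (intro C) auto
    ultimately show ?thesis
      using norm_triangle_ineq4[of "g (y r)" "g (y (grid_ceiling s (t / real k) r))"]
      by (simp add: \<delta>_def)
  qed
  have bnd: "norm (indicator {s<..s+t} r *\<^sub>R \<delta> (Suc k) r) \<le> indicator {s<..s+t} r *\<^sub>R (2 * C)" for r k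
    using \<delta>_bound[of r "Suc k"] by (cases "r \<in> {s<..s+t}") simp_all
  have ci: "integrable lborel (\<lambda>r. indicator {s<..s+t} r *\<^sub>R (2 * C))"
    using set_integrable_const_Ioc[of s "s+t" "2 * C"] by (simp add: set_integrable_def)
  have mesh: "(\<lambda>k. t / real k) \<longlonglongrightarrow> 0"
    by real_asymp
  have lim: "(\<lambda>k. \<delta> k r) \<longlonglongrightarrow> 0" if r: "r \<in> {s<..s+t}" for r
  proof -
    have yr: "(y \<longlongrightarrow> y r) (at_right r)"
      using path_solution_right_continuous[OF sol w g, of r] r s by (auto simp: continuous_within)
    have "isCont g (y r)"
      using lipschitz_on_continuous_on[OF g] by (simp add: continuous_on_eq_continuous_at)
    then have "((\<lambda>v. g (y v)) \<longlongrightarrow> g (y r)) (at_right r)"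
      by (rule isCont_tendsto_compose[OF _ yr])
    then have gr: "((\<lambda>v. norm (g (y r) - g (y v))) \<longlongrightarrow> norm (g (y r) - g (y r))) (at_right r)"
      by (intro tendsto_intros)
    show ?thesis
    proof (rule tendstoI)
      fix e :: real assume e: "0 < e"
      have "\<forall>\<^sub>F v in at_right r. dist (norm (g (y r) - g (y v))) 0 < e"
        using tendstoD[OF gr e] by simp
      then obtain b where b: "b > r" "\<And>v. r < v \<Longrightarrow> v < b \<Longrightarrow> norm (g (y r) - g (y v)) < e"
        unfolding eventually_at_right_field by auto
      have "\<forall>\<^sub>F k in sequentially. t / real k < b - r"
        using order_tendstoD(2)[OF mesh] b(1) by simp
      then show "\<forall>\<^sub>F k in sequentially. dist (\<delta> k r) 0 < e"
        using eventually_gt_at_top[of 0]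
      proof eventually_elim
        case (elim k)
        define v where "v = grid_ceiling s (t / real k) r"
        have "r \<le> v" "v < b"
          using grid_ceiling_bounds[where h="t / real k" and r=r and s=s] t elim by (auto simp: v_def)
        then have "norm (g (y r) - g (y v)) < e"
          using b(2)[of v] e by (cases "v = r") auto
        then show ?case by (simp add: \<delta>_def v_def)
      qed
    qed
  qed
  have I: "(\<lambda>k. LINT r:{s<..s+t}|lborel. \<delta> (Suc k) r) \<longlonglongrightarrow> (LINT r::real|lborel. 0)"
    unfolding set_lebesgue_integral_def
  proof (rule integral_dominated_convergence[where w="\<lambda>r. indicator {s<..s+t} r *\<^sub>R (2 * C)"])
    show "(\<lambda>r. indicator {s<..s+t} r *\<^sub>R \<delta> (Suc k) r) \<in> borel_measurable lborel" for k
      by (rule \<delta>_meas)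
    show "integrable lborel (\<lambda>r. indicator {s<..s+t} r *\<^sub>R (2 * C))"
      by (rule ci)
    show "AE r in lborel. (\<lambda>k. indicator {s<..s+t} r *\<^sub>R \<delta> (Suc k) r) \<longlonglongrightarrow> 0"
      using lim[THEN LIMSEQ_Suc] by (intro AE_I2) (auto simp: indicator_def)
    show "AE r in lborel. norm (indicator {s<..s+t} r *\<^sub>R \<delta> (Suc k) r) \<le> indicator {s<..s+t} r *\<^sub>R (2 * C)" for k
      using bnd by simp
  qed simp
  have "(\<lambda>k. y (s + t) - splitting g (\<lambda>_. t / real (Suc k))
      (increments w (grid s (t / real (Suc k)))) (z (Suc k)) (Suc k)) \<longlonglongrightarrow> 0"
  proof (rule Lim_null_comparison)
    show "\<forall>\<^sub>F k in sequentially. norm (y (s + t) - splitting g (\<lambda>_. t / real (Suc k))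
        (increments w (grid s (t / real (Suc k)))) (z (Suc k)) (Suc k))
      \<le> exp (L * t) * (norm (y s - z (Suc k)) + (LINT r:{s<..s+t}|lborel. \<delta> (Suc k) r)
          + L * C * t\<^sup>2 / real (Suc k))"
    proof (rule always_eventually, rule allI)
      fix k
      let ?k = "Suc k"
      let ?h = "t / real ?k"
      have end_eq: "grid s ?h ?k = s + t" by (rule grid_end) simp
      have "0 \<le> C" using norm_ge_zero C[of 0] s t by (meson add_nonneg_nonneg atLeastAtMost_iff less_imp_le order.trans order_refl)
      have \<delta>_nonneg: "0 \<le> (LINT r:{s<..s+t}|lborel. \<delta> ?k r)"
        unfolding set_lebesgue_integral_def \<delta>_def by (intro integral_nonneg_AE) auto
      have \<delta>_int: "set_integrable lborel {s<..grid s ?h ?k} (\<delta> ?k)"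
        unfolding set_integrable_def end_eq
        by (rule Bochner_Integration.integrable_bound[OF ci \<delta>_meas])
          (intro AE_I2, use bnd in \<open>force intro: order.trans[OF _ abs_ge_self]\<close>)
      have h: "0 < ?h" using t by simp
      have C': "norm (g (y r)) \<le> C" if "r \<in> {s..grid s ?h ?k}" for r
        using that s t unfolding end_eq by (intro C) auto
      have "norm (y (s + t) - splitting g (\<lambda>_. ?h) (increments w (grid s ?h)) (z ?k) ?k)
        \<le> (1 + L * ?h) ^ ?k * (norm (y s - z ?k) + (LINT r:{s<..s+t}|lborel. \<delta> ?k r)
            + real ?k * (L * C * ?h\<^sup>2))"
        using splitting_error[OF sol g s h C' \<delta>_def \<delta>_int order_refl, of "z ?k"]
        unfolding end_eq .
      also have "\<dots> \<le> exp (L * t) * (norm (y s - z ?k) + (LINT r:{s<..s+t}|lborel. \<delta> ?k r)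
            + real ?k * (L * C * ?h\<^sup>2))"
        using power_one_plus_le_exp[of "L * t" ?k] L t \<delta>_nonneg \<open>0 \<le> C\<close>
        by (intro mult_right_mono) (auto intro!: add_nonneg_nonneg)
      also have "real ?k * (L * C * ?h\<^sup>2) = L * C * t\<^sup>2 / real ?k"
        by (simp add: power2_eq_square field_simps del: of_nat_Suc)
      finally show "norm (y (s + t) - splitting g (\<lambda>_. ?h) (increments w (grid s ?h)) (z ?k) ?k)
        \<le> exp (L * t) * (norm (y s - z ?k) + (LINT r:{s<..s+t}|lborel. \<delta> ?k r)
          + L * C * t\<^sup>2 / real ?k)" .
    qed
    have "(\<lambda>k. L * C * t\<^sup>2 / real (Suc k)) \<longlonglongrightarrow> 0"
      by real_asymp
    moreover have "(\<lambda>k. norm (y s - z (Suc k))) \<longlonglongrightarrow> norm (y s - y s)"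
      by (intro tendsto_intros LIMSEQ_Suc z)
    ultimately have "(\<lambda>k. exp (L * t) * (norm (y s - z (Suc k)) + (LINT r:{s<..s+t}|lborel. \<delta> (Suc k) r)
          + L * C * t\<^sup>2 / real (Suc k))) \<longlonglongrightarrow> exp (L * t) * (norm (y s - y s) + (LINT r::real|lborel. 0) + 0)"
      by (intro tendsto_mult tendsto_add tendsto_const I)
    then show "(\<lambda>k. exp (L * t) * (norm (y s - z (Suc k)) + (LINT r:{s<..s+t}|lborel. \<delta> (Suc k) r)
          + L * C * t\<^sup>2 / real (Suc k))) \<longlonglongrightarrow> 0" by simp
  qed
  from tendsto_diff[OF tendsto_const[of "y (s + t)"] this]
  have "(\<lambda>k. splitting g (\<lambda>_. t / real (Suc k))
      (increments w (grid s (t / real (Suc k)))) (z (Suc k)) (Suc k)) \<longlonglongrightarrow> y (s + t)"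
    by (simp del: splitting.simps of_nat_Suc)
  then show ?thesis by (rule LIMSEQ_imp_Suc)
qed

section \<open>Contraction and growth of solutions\<close>

definition strongly_monotone :: "real \<Rightarrow> ('b::real_inner \<Rightarrow> 'b) \<Rightarrow> bool" where
  "strongly_monotone a g \<longleftrightarrow> (\<forall>x z. a * (norm (x - z))\<^sup>2 \<le> (x - z) \<bullet> (g x - g z))"

text \<open>The mean value theorem for \<open>\<theta> \<mapsto> (x - z) \<bullet> \<nabla>U (z + \<theta> (x - z))\<close> on \<open>[0, 1]\<close>.\<close>
lemma strongly_monotone_grad:
  fixes U :: "real ^ 'n \<Rightarrow> real"
  assumes "C2 U" and convex: "\<And>x v. a * (norm v)\<^sup>2 \<le> v \<bullet> (hessian U x *v v)"
  shows "strongly_monotone a (grad U)"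
  unfolding strongly_monotone_def
proof (intro allI)
  fix x z :: "real ^ 'n"
  have D: "(grad U has_derivative (\<lambda>v. hessian U q *v v)) (at q)" for q
    using assms(1) by (simp add: C2_def hessian_def flip: jacobian_works)
  define p where "p \<theta> = z + \<theta> *\<^sub>R (x - z)" for \<theta> :: real
  have "((\<lambda>\<theta>. (x - z) \<bullet> grad U (p \<theta>)) has_derivative
      (\<lambda>\<eta>. (x - z) \<bullet> (hessian U (p \<theta>) *v (\<eta> *\<^sub>R (x - z))))) (at \<theta>)" for \<theta>
    unfolding p_def
    by (rule has_derivative_inner_right, rule has_derivative_compose[OF _ D])
      (auto intro!: derivative_eq_intros)
  then have "((\<lambda>\<theta>. (x - z) \<bullet> grad U (p \<theta>)) has_real_derivative
      (x - z) \<bullet> (hessian U (p \<theta>) *v (x - z))) (at \<theta>)" for \<theta>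
    by (rule has_derivative_imp_has_field_derivative) (simp add: matrix_vector_mult_scaleR)
  then obtain \<theta> where "(x - z) \<bullet> grad U (p 1) - (x - z) \<bullet> grad U (p 0)
      = (1 - 0) * ((x - z) \<bullet> (hessian U (p \<theta>) *v (x - z)))"
    using MVT2[of 0 1 "\<lambda>\<theta>. (x - z) \<bullet> grad U (p \<theta>)" "\<lambda>\<theta>. (x - z) \<bullet> (hessian U (p \<theta>) *v (x - z))"]
    by auto
  then show "a * (norm (x - z))\<^sup>2 \<le> (x - z) \<bullet> (grad U x - grad U z)"
    using convex[of "x - z" "p \<theta>"] by (simp add: p_def inner_diff_right)
qed

text \<open>
  Expanding the square, monotonicity and the Lipschitz bound give the squared factor
  \<open>1 - 2 a h + L\<^sup>2 h\<^sup>2\<close>. It is bounded by an exponential so that the factors of \<open>t / h\<close> steps multiply to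
  \<open>exp (- a t)\<close> times an error that disappears with \<open>h\<close>.
\<close>
lemma drift_step_contraction:
  assumes g: "L-lipschitz_on UNIV g" and mono: "strongly_monotone a g" and h: "0 \<le> h"
  shows "norm ((x - h *\<^sub>R g x) - (z - h *\<^sub>R g z)) \<le> exp (- a * h + L\<^sup>2 * h\<^sup>2 / 2) * norm (x - z)"
proof (rule power2_le_imp_le)
  have "norm (g x - g z) \<le> L * norm (x - z)"
    using lipschitz_onD[OF g, of x z] by (simp add: dist_norm)
  then have 1: "(norm (g x - g z))\<^sup>2 \<le> L\<^sup>2 * (norm (x - z))\<^sup>2"
    by (metis norm_ge_zero power_mono power_mult_distrib)
  have 2: "a * (norm (x - z))\<^sup>2 \<le> (x - z) \<bullet> (g x - g z)"
    using mono by (simp add: strongly_monotone_def)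
  have "(norm ((x - h *\<^sub>R g x) - (z - h *\<^sub>R g z)))\<^sup>2 = (norm ((x - z) - h *\<^sub>R (g x - g z)))\<^sup>2"
    by (simp add: algebra_simps)
  also have "\<dots> = (norm (x - z))\<^sup>2 - 2 * h * ((x - z) \<bullet> (g x - g z)) + h\<^sup>2 * (norm (g x - g z))\<^sup>2"
    unfolding power2_norm_eq_inner by (simp add: inner_diff_left[of "x - z"] inner_diff_right[of _ "x - z"] inner_commute[of "g x - g z" "x - z"] power2_eq_square right_diff_distrib)
  also have "\<dots> \<le> (norm (x - z))\<^sup>2 - 2 * h * (a * (norm (x - z))\<^sup>2) + h\<^sup>2 * (L\<^sup>2 * (norm (x - z))\<^sup>2)"
    using 1 2 h by (intro add_mono diff_mono mult_left_mono) auto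
  also have "\<dots> = (1 + 2 * (- a * h + L\<^sup>2 * h\<^sup>2 / 2)) * (norm (x - z))\<^sup>2"
    by (simp add: algebra_simps)
  also have "\<dots> \<le> exp (2 * (- a * h + L\<^sup>2 * h\<^sup>2 / 2)) * (norm (x - z))\<^sup>2"
    by (intro mult_right_mono exp_ge_add_one_self) simp
  also have "\<dots> = (exp (- a * h + L\<^sup>2 * h\<^sup>2 / 2) * norm (x - z))\<^sup>2"
    by (simp only: power_mult_distrib exp_double)
  finally show "(norm ((x - h *\<^sub>R g x) - (z - h *\<^sub>R g z)))\<^sup>2
      \<le> (exp (- a * h + L\<^sup>2 * h\<^sup>2 / 2) * norm (x - z))\<^sup>2" .
qed simp

lemma splitting_contraction:
  assumes g: "L-lipschitz_on UNIV g" and mono: "strongly_monotone a g" and h: "0 \<le> h"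
  shows "norm (splitting g (\<lambda>_. h) d x j - splitting g (\<lambda>_. h) d z j)
    \<le> exp (real j * (- a * h + L\<^sup>2 * h\<^sup>2 / 2)) * norm (x - z)"
proof (induction j)
  case (Suc j)
  let ?q = "- a * h + L\<^sup>2 * h\<^sup>2 / 2"
  have "norm (splitting g (\<lambda>_. h) d x (Suc j) - splitting g (\<lambda>_. h) d z (Suc j))
      \<le> exp ?q * norm (splitting g (\<lambda>_. h) d x j - splitting g (\<lambda>_. h) d z j)"
    using drift_step_contraction[OF g mono h,
        of "splitting g (\<lambda>_. h) d x j + d j" "splitting g (\<lambda>_. h) d z j + d j"] by simp
  also have "\<dots> \<le> exp ?q * (exp (real j * ?q) * norm (x - z))"
    using Suc by (intro mult_left_mono) auto
  also have "\<dots> = exp (real (Suc j) * ?q) * norm (x - z)"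
    by (simp add: distrib_right exp_add)
  finally show ?case .
qed simp

lemma splitting_contraction_grid:
  assumes "L-lipschitz_on UNIV g" "strongly_monotone a g" "0 < t" "0 < k"
  shows "norm (splitting g (\<lambda>_. t / real k) d x k - splitting g (\<lambda>_. t / real k) d z k)
    \<le> exp (- a * t + L\<^sup>2 * t\<^sup>2 / (2 * real k)) * norm (x - z)"
proof -
  have "real k * (- a * (t / real k) + L\<^sup>2 * (t / real k)\<^sup>2 / 2) = - a * t + L\<^sup>2 * t\<^sup>2 / (2 * real k)"
    using assms(4) by (simp add: field_simps power2_eq_square)
  then show ?thesis
    using splitting_contraction[OF assms(1,2), of "t / real k" d x k z] assms(3,4) by simp
qed

text \<open>
  Both solutions are limits of the scheme with the same noise increments and different starting
  points, and \<open>k\<close> steps of it contract by \<open>exp (- a t)\<close> up to a factor that tends to \<open>1\<close>.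
\<close>
lemma path_solution_contraction:
  assumes sol: "path_solution g w y" "path_solution g w y'" and w: "cadlag w"
    and g: "L-lipschitz_on UNIV g" and mono: "strongly_monotone a g" and t: "0 \<le> t"
  shows "norm (y t - y' t) \<le> exp (- a * t) * norm (y 0 - y' 0)"
proof (cases "t = 0")
  case False
  with t have t: "0 < t" by simp
  let ?E = "\<lambda>x k. splitting g (\<lambda>_. t / real k) (increments w (grid 0 (t / real k))) x k"
  have "(\<lambda>k. ?E (y 0) k) \<longlonglongrightarrow> y (0 + t)" "(\<lambda>k. ?E (y' 0) k) \<longlonglongrightarrow> y' (0 + t)"
    by (rule splitting_tendsto[OF sol(1) w g order_refl t tendsto_const]
        splitting_tendsto[OF sol(2) w g order_refl t tendsto_const])+
  then have l1: "(\<lambda>k. norm (?E (y 0) k - ?E (y' 0) k)) \<longlonglongrightarrow> norm (y t - y' t)"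
    by (intro tendsto_intros) simp_all
  have l2: "(\<lambda>k. exp (- a * t + L\<^sup>2 * t\<^sup>2 / (2 * real k)) * norm (y 0 - y' 0))
      \<longlonglongrightarrow> exp (- a * t + 0) * norm (y 0 - y' 0)"
    by (intro tendsto_intros tendsto_divide_0[OF tendsto_const]) real_asymp
  have "\<forall>\<^sub>F k in sequentially. norm (?E (y 0) k - ?E (y' 0) k)
      \<le> exp (- a * t + L\<^sup>2 * t\<^sup>2 / (2 * real k)) * norm (y 0 - y' 0)"
    using eventually_gt_at_top[of 0] by eventually_elim (rule splitting_contraction_grid[OF g mono t])
  from tendsto_le[OF sequentially_bot l2 l1 this] show ?thesis by simp
qed simp

lemma lipschitz_linear_growth:
  fixes g :: "'b::real_normed_vector \<Rightarrow> 'c::real_normed_vector"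
  assumes "L-lipschitz_on UNIV g"
  shows "norm (g x) \<le> norm (g 0) + L * norm x"
  using lipschitz_onD[OF assms, of x 0] norm_triangle_sub[of "g x" "g 0"] by (simp add: dist_norm)

text \<open>
  Without its accumulated noise \<open>W\<close>, the scheme moves only by drift terms of size at most
  \<open>h * (norm (g 0) + L * (norm F + S))\<close>; the bound is therefore linear in \<open>S\<close>, however many increments
  have been added.
\<close>
lemma splitting_growth:
  assumes g: "L-lipschitz_on UNIV g" and h: "0 \<le> h"
    and S: "\<And>j. j \<le> k \<Longrightarrow> norm (W j) \<le> S" and W0: "W 0 = 0" and j: "j \<le> k"
  shows "norm (splitting g (\<lambda>_. h) (\<lambda>j. W (Suc j) - W j) x j - W j)
    \<le> (1 + L * h) ^ j * (norm x + real j * (h * (norm (g 0) + L * S)))"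
  using j
proof (induction j)
  case 0
  then show ?case by (simp add: W0)
next
  case (Suc j)
  have L: "0 \<le> L" using g by (rule lipschitz_on_nonneg)
  have S0: "0 \<le> S" using S[of 0] by (simp add: W0)
  define F where "F = splitting g (\<lambda>_. h) (\<lambda>j. W (Suc j) - W j) x j - W j"
  define c where "c = h * (norm (g 0) + L * S)"
  define q where "q = 1 + L * h"
  have c: "0 \<le> c" and q: "1 \<le> q" using L S0 h by (simp_all add: c_def q_def)
  have "norm (g (F + W (Suc j))) \<le> norm (g 0) + L * norm (F + W (Suc j))"
    by (rule lipschitz_linear_growth[OF g])
  also have "\<dots> \<le> norm (g 0) + L * (norm F + S)"
    using L S[OF Suc.prems] by (intro add_left_mono mult_left_mono order.trans[OF norm_triangle_ineq]) auto
  finally have 1: "h * norm (g (F + W (Suc j))) \<le> h * (norm (g 0) + L * (norm F + S))"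
    using h by (rule mult_left_mono)
  have "splitting g (\<lambda>_. h) (\<lambda>j. W (Suc j) - W j) x (Suc j) - W (Suc j) = F - h *\<^sub>R g (F + W (Suc j))"
    by (simp add: F_def algebra_simps)
  also have "norm \<dots> \<le> norm F + h * norm (g (F + W (Suc j)))"
    using norm_triangle_ineq4[of F "h *\<^sub>R g (F + W (Suc j))"] h by simp
  also have "\<dots> \<le> q * norm F + c"
    using 1 by (simp add: c_def q_def algebra_simps)
  also have "\<dots> \<le> q * (q ^ j * (norm x + real j * c)) + q ^ Suc j * c"
  proof (rule add_mono)
    show "q * norm F \<le> q * (q ^ j * (norm x + real j * c))"
      using Suc q by (intro mult_left_mono) (simp_all add: F_def c_def q_def)
    show "c \<le> q ^ Suc j * c"
      using mult_right_mono[OF one_le_power[OF q, of "Suc j"] c] by simp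
  qed
  also have "\<dots> = q ^ Suc j * (norm x + real (Suc j) * c)"
    by (simp add: algebra_simps)
  finally show ?case unfolding c_def q_def .
qed

lemma path_solution_growth:
  assumes sol: "path_solution g w y" and w: "cadlag w" and g: "L-lipschitz_on UNIV g"
    and t: "0 < t" and S: "\<And>u. u \<in> {0..t} \<Longrightarrow> norm (w u - w 0) \<le> S"
  shows "norm (y t) \<le> exp (L * t) * (norm (y 0) + t * (norm (g 0) + L * S)) + S"
proof -
  have L: "0 \<le> L" using g by (rule lipschitz_on_nonneg)
  have S0: "0 \<le> S" using S[of 0] t by simp
  let ?E = "\<lambda>k. splitting g (\<lambda>_. t / real k) (increments w (grid 0 (t / real k))) (y 0) k"
  have bound: "norm (?E k) \<le> exp (L * t) * (norm (y 0) + t * (norm (g 0) + L * S)) + S"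
    if k: "0 < k" for k
  proof -
    define W where "W j = w (grid 0 (t / real k) j) - w 0" for j
    have Wb: "norm (W j) \<le> S" if "j \<le> k" for j
      unfolding W_def using that t k
      by (intro S) (auto simp: grid_def field_simps mult_left_mono)
    have inc: "increments w (grid 0 (t / real k)) = (\<lambda>j. W (Suc j) - W j)"
      by (simp add: increments_def W_def fun_eq_iff)
    have "norm (?E k - W k) \<le> (1 + L * (t / real k)) ^ k
        * (norm (y 0) + real k * (t / real k * (norm (g 0) + L * S)))"
      unfolding inc by (rule splitting_growth[OF g _ Wb]) (use t in \<open>auto simp: W_def grid_def\<close>)
    also have "\<dots> \<le> exp (L * t) * (norm (y 0) + real k * (t / real k * (norm (g 0) + L * S)))"
      using power_one_plus_le_exp[of "L * t" k] k L S0 t by (intro mult_right_mono) auto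
    also have "\<dots> = exp (L * t) * (norm (y 0) + t * (norm (g 0) + L * S))"
      using k by simp
    finally show ?thesis
      using norm_triangle_sub[of "?E k" "W k"] Wb[of k] by simp
  qed
  have l: "(\<lambda>k. norm (?E k)) \<longlonglongrightarrow> norm (y (0 + t))"
    by (intro tendsto_norm splitting_tendsto[OF sol w g order_refl t tendsto_const])
  have "\<forall>\<^sub>F k in sequentially. norm (?E k)
      \<le> exp (L * t) * (norm (y 0) + t * (norm (g 0) + L * S)) + S"
    using eventually_gt_at_top[of 0] by eventually_elim (rule bound)
  from tendsto_upperbound[OF l this] show ?thesis by simp
qed

section \<open>Bounded Lipschitz functions determine a measure\<close>

text \<open>
  This class of test functions determines measures, is preserved by the Markov operators below, and
  the Lipschitz constant records how fast these operators contract.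
\<close>
definition bounded_lipschitz :: "('b::metric_space \<Rightarrow> real) \<Rightarrow> bool" where
  "bounded_lipschitz f \<longleftrightarrow> (\<exists>B. \<forall>x. \<bar>f x\<bar> \<le> B) \<and> (\<exists>C. C-lipschitz_on UNIV f)"

lemma bounded_lipschitzI:
  "(\<And>x. \<bar>f x\<bar> \<le> B) \<Longrightarrow> C-lipschitz_on UNIV f \<Longrightarrow> bounded_lipschitz f"
  by (auto simp: bounded_lipschitz_def)

lemma bounded_lipschitzE:
  assumes "bounded_lipschitz f"
  obtains B C where "\<And>x. \<bar>f x\<bar> \<le> B" "C-lipschitz_on UNIV f"
  using assms by (auto simp: bounded_lipschitz_def)

lemma bounded_lipschitz_isCont: "bounded_lipschitz f \<Longrightarrow> isCont f x"
  by (auto simp: bounded_lipschitz_def continuous_on_eq_continuous_at dest!: lipschitz_on_continuous_on)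

lemma bounded_lipschitz_measurable: "bounded_lipschitz f \<Longrightarrow> f \<in> borel_measurable borel"
  by (intro borel_measurable_continuous_onI continuous_at_imp_continuous_on ballI bounded_lipschitz_isCont)

text \<open>The indicator of a closed set \<open>F\<close> is the limit of \<open>max 0 (1 - n * infdist x F)\<close>.\<close>
lemma measure_eqI_bounded_lipschitz:
  fixes \<mu> \<nu> :: "'b::metric_space measure"
  assumes \<mu>: "sets \<mu> = sets borel" "prob_space \<mu>" and \<nu>: "sets \<nu> = sets borel" "prob_space \<nu>"
    and eq: "\<And>f. bounded_lipschitz f \<Longrightarrow> (\<integral>x. f x \<partial>\<mu>) = (\<integral>x. f x \<partial>\<nu>)"
  shows "\<mu> = \<nu>"
proof -
  interpret \<mu>: prob_space \<mu> by fact
  interpret \<nu>: prob_space \<nu> by fact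
  have closed_eq: "measure \<mu> F = measure \<nu> F" if F: "closed F" for F
  proof (cases "F = {}")
    case False
    define f where "f n x = max 0 (1 - real n * infdist x F)" for n x
    have f01: "0 \<le> f n x" "f n x \<le> 1" for n x
      by (auto simp: f_def infdist_nonneg)
    have bl: "bounded_lipschitz (f n)" for n
    proof (rule bounded_lipschitzI[of _ 1])
      show "(real n)-lipschitz_on UNIV (f n)"
      proof (rule lipschitz_onI)
        fix x y :: 'b
        have "\<bar>infdist x F - infdist y F\<bar> \<le> dist x y" by (rule infdist_triangle_abs)
        then have "real n * \<bar>infdist x F - infdist y F\<bar> \<le> real n * dist x y"
          by (rule mult_left_mono) simp
        moreover have "\<bar>real n * infdist x F - real n * infdist y F\<bar> = real n * \<bar>infdist x F - infdist y F\<bar>"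
          by (simp add: abs_mult flip: right_diff_distrib)
        ultimately show "dist (f n x) (f n y) \<le> real n * dist x y"
          unfolding f_def dist_real_def by linarith
      qed simp
    qed (use f01 in \<open>simp add: abs_le_iff order_trans[OF _ f01(1)]\<close>)
    have lim: "(\<lambda>n. f n x) \<longlonglongrightarrow> indicator F x" for x
    proof (cases "x \<in> F")
      case False
      then have pos: "0 < infdist x F"
        using F \<open>F \<noteq> {}\<close> by (simp add: infdist_pos_not_in_closed)
      have "\<forall>\<^sub>F n in sequentially. f n x = 0"
      proof -
        have "\<forall>\<^sub>F n in sequentially. 1 / infdist x F < real n"
          by (rule eventually_gt_at_top[of "1 / infdist x F", THEN eventually_compose_filterlim])
            (rule filterlim_real_sequentially)
        then show ?thesis
          by eventually_elim (use pos in \<open>simp add: f_def field_simps\<close>)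
      qed
      with False show ?thesis by (simp add: tendsto_eventually)
    qed (simp add: f_def)
    have int_lim: "(\<lambda>n. \<integral>x. f n x \<partial>\<rho>) \<longlonglongrightarrow> measure \<rho> F"
      if \<rho>: "sets \<rho> = sets borel" "prob_space \<rho>" for \<rho>
    proof -
      interpret \<rho>: prob_space \<rho> by fact
      have [measurable_cong]: "sets \<rho> = sets borel" by fact
      have [measurable]: "f n \<in> borel_measurable borel" for n
        by (rule bounded_lipschitz_measurable[OF bl])
      have [measurable]: "F \<in> sets borel" using F by simp
      have "(\<lambda>n. \<integral>x. f n x \<partial>\<rho>) \<longlonglongrightarrow> (\<integral>x. indicator F x \<partial>\<rho>)"
        by (rule integral_dominated_convergence[where w="\<lambda>_. 1"])
          (use lim f01 in \<open>auto simp: \<rho>(1)\<close>)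
      then show ?thesis using \<rho>(1) F by simp
    qed
    have "(\<lambda>n. \<integral>x. f n x \<partial>\<mu>) \<longlonglongrightarrow> measure \<nu> F"
      unfolding eq[OF bl] by (rule int_lim[OF \<nu>])
    then show ?thesis
      using int_lim[OF \<mu>] by (rule LIMSEQ_unique[THEN sym])
  qed simp
  show ?thesis
  proof (rule measure_eqI_generator_eq[where E="Collect closed" and \<Omega>=UNIV and A="\<lambda>_. UNIV"])
    show "Int_stable (Collect closed :: 'b set set)" by (auto simp: Int_stable_def)
    show "emeasure \<mu> F = emeasure \<nu> F" if "F \<in> Collect closed" for F
      using closed_eq that by (simp add: \<mu>.emeasure_eq_measure \<nu>.emeasure_eq_measure)
    show "sets \<mu> = sigma_sets UNIV (Collect closed)" "sets \<nu> = sigma_sets UNIV (Collect closed)"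
      unfolding \<mu>(1) \<nu>(1) by (simp_all add: borel_eq_closed)
  qed (auto simp: \<mu>.emeasure_eq_measure)
qed

section \<open>Random Lipschitz maps and their invariant measures\<close>

lemma geometric_step_convergence:
  fixes Y :: "nat \<Rightarrow> 'c::banach"
  assumes r: "0 < r" "r < 1" and step: "\<And>k. norm (Y (Suc k) - Y k) \<le> c * r ^ k"
  shows "convergent Y" and "norm (lim Y - Y 0) \<le> c / (1 - r)"
proof -
  have geo: "(\<lambda>k. c * r ^ k) sums (c * (1 / (1 - r)))"
    using r by (intro sums_mult geometric_sums) simp
  have sn: "summable (\<lambda>k. norm (Y (Suc k) - Y k))"
    by (rule summable_comparison_test'[OF sums_summable[OF geo], of 0]) (use step in simp)
  have "(\<lambda>n. \<Sum>k<n. Y (Suc k) - Y k) \<longlonglongrightarrow> (\<Sum>k. Y (Suc k) - Y k)"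
    by (rule summable_LIMSEQ[OF summable_norm_cancel[OF sn]])
  then have "(\<lambda>n. (Y n - Y 0) + Y 0) \<longlonglongrightarrow> (\<Sum>k. Y (Suc k) - Y k) + Y 0"
    unfolding sum_lessThan_telescope by (intro tendsto_intros)
  then have lim: "Y \<longlonglongrightarrow> (\<Sum>k. Y (Suc k) - Y k) + Y 0" by simp
  then show "convergent Y" by (auto simp: convergent_def)
  have "norm (lim Y - Y 0) = norm (\<Sum>k. Y (Suc k) - Y k)"
    using limI[OF lim] by simp
  also have "\<dots> \<le> (\<Sum>k. norm (Y (Suc k) - Y k))" by (rule summable_norm[OF sn])
  also have "\<dots> \<le> (\<Sum>k. c * r ^ k)"
    by (rule suminf_le[OF step sn sums_summable[OF geo]])
  also have "\<dots> = c / (1 - r)" using sums_unique[OF geo] by simp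
  finally show "norm (lim Y - Y 0) \<le> c / (1 - r)" .
qed

text \<open>
  The exceptional null set may depend on the pair \<open>(x, z)\<close>. This is all that is known when a solution
  is given for each starting point separately, and it suffices for statements about expectations.
\<close>
locale random_lipschitz_map = prob_space M for M :: "'w measure" +
  fixes \<phi> :: "'b::euclidean_space \<times> 'w \<Rightarrow> 'b" and q :: real
  assumes map_measurable [measurable]: "\<phi> \<in> borel_measurable (borel \<Otimes>\<^sub>M M)"
    and q_nonneg: "0 \<le> q"
    and map_lipschitz: "\<And>x z. AE \<omega> in M. norm (\<phi> (x, \<omega>) - \<phi> (z, \<omega>)) \<le> q * norm (x - z)"
begin

text \<open>The Markov operator \<open>f \<mapsto> Pf\<close> of the random map; \<open>push\<close> is its dual \<open>\<nu> \<mapsto> \<nu>P\<close>.\<close>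
definition operator :: "('b \<Rightarrow> real) \<Rightarrow> 'b \<Rightarrow> real" where
  "operator f x = (\<integral>\<omega>. f (\<phi> (x, \<omega>)) \<partial>M)"

definition push :: "'b measure \<Rightarrow> 'b measure" where
  "push \<nu> = distr (\<nu> \<Otimes>\<^sub>M M) borel \<phi>"

lemma slice_measurable [measurable]: "(\<lambda>\<omega>. \<phi> (x, \<omega>)) \<in> borel_measurable M"
  by measurable

lemma slice_integrable:
  assumes [measurable]: "f \<in> borel_measurable borel" and "\<And>x. \<bar>f x\<bar> \<le> (B::real)"
  shows "integrable M (\<lambda>\<omega>. f (\<phi> (x, \<omega>)))"
  by (rule integrable_const_bound[where B=B]) (use assms in auto)

lemma operator_bound:
  assumes "f \<in> borel_measurable borel" and B: "\<And>x. \<bar>f x\<bar> \<le> B"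
  shows "\<bar>operator f x\<bar> \<le> B"
proof -
  have "\<bar>operator f x\<bar> \<le> (\<integral>\<omega>. \<bar>f (\<phi> (x, \<omega>))\<bar> \<partial>M)"
    unfolding operator_def by (rule integral_abs_bound)
  also have "\<dots> \<le> (\<integral>\<omega>. B \<partial>M)"
    using slice_integrable[OF assms] B by (intro integral_mono) auto
  finally show ?thesis by (simp add: prob_space)
qed

lemma operator_lipschitz:
  assumes B: "\<And>x. \<bar>f x\<bar> \<le> B" and C: "C-lipschitz_on UNIV f"
  shows "(C * q)-lipschitz_on UNIV (operator f)"
proof (rule lipschitz_onI)
  have bl: "bounded_lipschitz f" using assms by (rule bounded_lipschitzI)
  note int = slice_integrable[OF bounded_lipschitz_measurable[OF bl] B]
  have C0: "0 \<le> C" using C by (rule lipschitz_on_nonneg)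
  fix x z :: 'b
  have "\<bar>operator f x - operator f z\<bar> = \<bar>\<integral>\<omega>. f (\<phi> (x, \<omega>)) - f (\<phi> (z, \<omega>)) \<partial>M\<bar>"
    unfolding operator_def using int by simp
  also have "\<dots> \<le> (\<integral>\<omega>. \<bar>f (\<phi> (x, \<omega>)) - f (\<phi> (z, \<omega>))\<bar> \<partial>M)"
    by (rule integral_abs_bound)
  also have "\<dots> \<le> (\<integral>\<omega>. C * q * dist x z \<partial>M)"
  proof (rule integral_mono_AE)
    show "AE \<omega> in M. \<bar>f (\<phi> (x, \<omega>)) - f (\<phi> (z, \<omega>))\<bar> \<le> C * q * dist x z"
      using map_lipschitz[of x z]
    proof eventually_elim
      case (elim \<omega>)
      have "\<bar>f (\<phi> (x, \<omega>)) - f (\<phi> (z, \<omega>))\<bar> \<le> C * norm (\<phi> (x, \<omega>) - \<phi> (z, \<omega>))"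
        using lipschitz_onD[OF C, of "\<phi> (x, \<omega>)" "\<phi> (z, \<omega>)"] by (simp add: dist_norm)
      also have "\<dots> \<le> C * (q * norm (x - z))" using elim C0 by (rule mult_left_mono)
      finally show ?case by (simp add: dist_norm mult.assoc)
    qed
  qed (use int in auto)
  finally show "dist (operator f x) (operator f z) \<le> C * q * dist x z"
    by (simp add: dist_real_def prob_space)
qed (use lipschitz_on_nonneg[OF C] q_nonneg in simp)

lemma operator_bounded_lipschitz: "bounded_lipschitz f \<Longrightarrow> bounded_lipschitz (operator f)"
  by (metis bounded_lipschitzE bounded_lipschitzI bounded_lipschitz_measurable operator_bound
      operator_lipschitz)

lemma push_prob_space:
  assumes "prob_space \<nu>" "sets \<nu> = sets borel"
  shows "prob_space (push \<nu>)"
proof -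
  interpret \<nu>: prob_space \<nu> by fact
  interpret pair_prob_space \<nu> M ..
  have [measurable_cong]: "sets \<nu> = sets borel" by fact
  show ?thesis unfolding push_def by (rule P.prob_space_distr) measurable
qed

lemma integral_push:
  assumes "prob_space \<nu>" "sets \<nu> = sets borel" and f: "bounded_lipschitz f"
  shows "(\<integral>x. f x \<partial>push \<nu>) = (\<integral>x. operator f x \<partial>\<nu>)"
proof -
  interpret \<nu>: prob_space \<nu> by fact
  interpret pair_prob_space \<nu> M ..
  have [measurable_cong]: "sets \<nu> = sets borel" by fact
  have [measurable]: "f \<in> borel_measurable borel" by (rule bounded_lipschitz_measurable[OF f])
  obtain B where B: "\<And>x. \<bar>f x\<bar> \<le> B" using f by (auto simp: bounded_lipschitz_def)
  have int: "integrable (\<nu> \<Otimes>\<^sub>M M) (\<lambda>(x, \<omega>). f (\<phi> (x, \<omega>)))"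
    by (rule P.integrable_const_bound[where B=B]) (use B in auto)
  have "(\<integral>x. f x \<partial>push \<nu>) = (\<integral>z. (case z of (x, \<omega>) \<Rightarrow> f (\<phi> (x, \<omega>))) \<partial>(\<nu> \<Otimes>\<^sub>M M))"
    unfolding push_def by (subst integral_distr) (simp_all add: case_prod_beta')
  also have "\<dots> = (\<integral>x. operator f x \<partial>\<nu>)"
    unfolding operator_def by (rule integral_fst'[OF int, simplified, symmetric])
  finally show ?thesis .
qed

text \<open>
  The \<open>k\<close>-th iterate of the operator on \<open>f\<close> has Lipschitz constant \<open>C * q ^ k\<close>, hence becomes flat. Its
  integral against an invariant law is always the integral of \<open>f\<close>, so this integral is the limit of the
  values of the iterates at \<open>0\<close>, for every invariant law.
\<close>
lemma fixed_point_unique: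
  assumes q: "q < 1"
    and \<mu>: "prob_space \<mu>" "sets \<mu> = sets borel" "push \<mu> = \<mu>"
    and \<nu>: "prob_space \<nu>" "sets \<nu> = sets borel" "push \<nu> = \<nu>"
  shows "\<mu> = \<nu>"
proof (rule measure_eqI_bounded_lipschitz[OF \<mu>(2,1) \<nu>(2,1)])
  fix f :: "'b \<Rightarrow> real" assume f: "bounded_lipschitz f"
  from f obtain B C where B: "\<And>x. \<bar>f x\<bar> \<le> B" and C: "C-lipschitz_on UNIV f"
    by (erule bounded_lipschitzE)
  define F where "F k = (operator ^^ k) f" for k
  have F: "(\<forall>x. \<bar>F k x\<bar> \<le> B) \<and> (C * q ^ k)-lipschitz_on UNIV (F k)" for k
  proof (induction k)
    case (Suc k)
    then have bl: "bounded_lipschitz (F k)" by (auto intro: bounded_lipschitzI)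
    show ?case
      using operator_bound[OF bounded_lipschitz_measurable[OF bl], of B]
        operator_lipschitz[of "F k" B "C * q ^ k"] Suc
      by (simp add: F_def mult_ac)
  qed (use B C in \<open>simp add: F_def\<close>)
  then have bl: "bounded_lipschitz (F k)" for k by (auto intro: bounded_lipschitzI)
  have lim: "(\<lambda>k. F k x - F k 0) \<longlonglongrightarrow> 0" for x
  proof (rule Lim_null_comparison)
    show "\<forall>\<^sub>F k in sequentially. norm (F k x - F k 0) \<le> C * q ^ k * norm x"
    proof (rule always_eventually, rule allI)
      fix k
      show "norm (F k x - F k 0) \<le> C * q ^ k * norm x"
        using lipschitz_onD[of "C * q ^ k" UNIV "F k" x 0] F by (simp add: dist_norm)
    qed
    have "(\<lambda>k. C * q ^ k * norm x) \<longlonglongrightarrow> C * 0 * norm x"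
      using q q_nonneg by (intro tendsto_intros LIMSEQ_realpow_zero)
    then show "(\<lambda>k. C * q ^ k * norm x) \<longlonglongrightarrow> 0" by simp
  qed
  have conv: "(\<lambda>k. (\<integral>x. f x \<partial>\<rho>) - F k 0) \<longlonglongrightarrow> 0"
    if \<rho>: "prob_space \<rho>" "sets \<rho> = sets borel" "push \<rho> = \<rho>" for \<rho>
  proof -
    interpret \<rho>: prob_space \<rho> by fact
    have [measurable_cong]: "sets \<rho> = sets borel" by fact
    have [measurable]: "F k \<in> borel_measurable borel" for k
      by (rule bounded_lipschitz_measurable[OF bl])
    have "(\<integral>x. F k x \<partial>\<rho>) = (\<integral>x. f x \<partial>\<rho>)" for k
    proof (induction k)
      case (Suc k)
      then show ?case
        using integral_push[OF \<rho>(1,2) bl[of k]] unfolding \<rho>(3) by (simp add: F_def)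
    qed (simp add: F_def)
    moreover have "integrable \<rho> (F k)" for k
      by (rule \<rho>.integrable_const_bound[where B=B]) (use F in auto)
    ultimately have eq: "(\<integral>x. F k x - F k 0 \<partial>\<rho>) = (\<integral>x. f x \<partial>\<rho>) - F k 0" for k
      by (simp add: \<rho>.prob_space)
    have "(\<lambda>k. \<integral>x. F k x - F k 0 \<partial>\<rho>) \<longlonglongrightarrow> (\<integral>x. 0 \<partial>\<rho>)"
    proof (rule integral_dominated_convergence[where w="\<lambda>_. 2 * B"])
      show "AE x in \<rho>. norm (F k x - F k 0) \<le> 2 * B" for k
      proof (rule AE_I2)
        fix x
        have "\<bar>F k x\<bar> \<le> B" "\<bar>F k 0\<bar> \<le> B" using F by blast+
        then show "norm (F k x - F k 0) \<le> 2 * B" by simp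
      qed
    qed (use lim in auto)
    then show ?thesis unfolding eq by simp
  qed
  have "(\<lambda>k. ((\<integral>x. f x \<partial>\<mu>) - F k 0) - ((\<integral>x. f x \<partial>\<nu>) - F k 0)) \<longlonglongrightarrow> 0 - 0"
    by (intro tendsto_diff conv \<mu> \<nu>)
  then show "(\<integral>x. f x \<partial>\<mu>) = (\<integral>x. f x \<partial>\<nu>)"
    by (simp add: LIMSEQ_const_iff)
qed

text \<open>
  The newest random map is applied innermost: \<open>\<phi>\<^sub>0 (\<phi>\<^sub>1 (\<dots> \<phi>\<^sub>k\<^sub>-\<^sub>1 (0)))\<close>. Composing in the opposite order
  gives variables with the same laws, which in general do not converge almost surely.
\<close>
primrec backward :: "nat \<Rightarrow> (nat \<Rightarrow> 'w) \<Rightarrow> 'b" where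
  "backward 0 \<omega> = 0"
| "backward (Suc k) \<omega> = \<phi> (backward k (\<lambda>i. \<omega> (Suc i)), \<omega> 0)"

abbreviation sequences :: "(nat \<Rightarrow> 'w) measure" where
  "sequences \<equiv> PiM UNIV (\<lambda>_. M)"

lemma backward_measurable [measurable]: "backward k \<in> borel_measurable sequences"
proof (induction k)
  case (Suc k)
  have [measurable]: "(\<lambda>\<omega> i. \<omega> (Suc i)) \<in> measurable sequences sequences"
    by (rule measurable_PiM_single') (auto simp: space_PiM)
  note [measurable] = Suc
  have "(\<lambda>\<omega>. \<phi> (backward k (\<lambda>i. \<omega> (Suc i)), \<omega> 0)) \<in> borel_measurable sequences"
    by measurable
  then show ?case by simp
qed simp

lemma prob_space_sequences: "prob_space sequences"
  by (rule prob_space_PiM) (rule prob_space_axioms)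

lemma distr_case_nat: "distr (M \<Otimes>\<^sub>M sequences) sequences (\<lambda>(s, \<omega>). case_nat s \<omega>) = sequences"
proof -
  interpret sequence_space M by unfold_locales
  show ?thesis by (rule PiM_iter)
qed

text \<open>
  Under an independent sequence of realisations, the first one is independent of the remaining
  sequence, and the latter has the law of the whole.
\<close>
lemma nn_integral_sequences:
  assumes [measurable]: "F \<in> borel_measurable sequences"
  shows "(\<integral>\<^sup>+\<omega>. F \<omega> \<partial>sequences) = (\<integral>\<^sup>+\<omega>. \<integral>\<^sup>+s. F (case_nat s \<omega>) \<partial>M \<partial>sequences)"
proof -
  interpret S: prob_space sequences by (rule prob_space_sequences)
  interpret pair_prob_space M sequences ..
  have "(\<integral>\<^sup>+\<omega>. F \<omega> \<partial>sequences) = (\<integral>\<^sup>+z. F (case z of (s, \<omega>) \<Rightarrow> case_nat s \<omega>) \<partial>(M \<Otimes>\<^sub>M sequences))"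
    by (subst distr_case_nat[symmetric], subst nn_integral_distr) auto
  also have "\<dots> = (\<integral>\<^sup>+\<omega>. \<integral>\<^sup>+s. F (case_nat s \<omega>) \<partial>M \<partial>sequences)"
    by (subst nn_integral_snd[symmetric]) (auto simp: case_prod_beta')
  finally show ?thesis .
qed

lemma integral_backward_Suc:
  assumes f: "bounded_lipschitz f"
  shows "(\<integral>\<omega>. f (backward (Suc k) \<omega>) \<partial>sequences) = (\<integral>\<omega>. operator f (backward k \<omega>) \<partial>sequences)"
proof -
  interpret S: prob_space sequences by (rule prob_space_sequences)
  interpret pair_prob_space M sequences ..
  have [measurable]: "f \<in> borel_measurable borel" by (rule bounded_lipschitz_measurable[OF f])
  obtain B where B: "\<And>x. \<bar>f x\<bar> \<le> B" using f by (auto simp: bounded_lipschitz_def)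
  have int: "integrable (M \<Otimes>\<^sub>M sequences) (\<lambda>(s, \<omega>). f (\<phi> (backward k \<omega>, s)))"
    by (rule P.integrable_const_bound[where B=B]) (use B in auto)
  have "(\<integral>\<omega>. f (backward (Suc k) \<omega>) \<partial>sequences)
      = (\<integral>z. f (backward (Suc k) (case z of (s, \<omega>) \<Rightarrow> case_nat s \<omega>)) \<partial>(M \<Otimes>\<^sub>M sequences))"
    by (subst distr_case_nat[symmetric], subst integral_distr) (auto simp del: backward.simps)
  also have "\<dots> = (\<integral>z. (case z of (s, \<omega>) \<Rightarrow> f (\<phi> (backward k \<omega>, s))) \<partial>(M \<Otimes>\<^sub>M sequences))"
    by (simp add: case_prod_beta')
  also have "\<dots> = (\<integral>\<omega>. operator f (backward k \<omega>) \<partial>sequences)"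
    unfolding operator_def by (rule integral_snd[OF int, symmetric])
  finally show ?thesis .
qed

definition moment0 :: ennreal where
  "moment0 = (\<integral>\<^sup>+\<omega>. ennreal ((norm (\<phi> (0, \<omega>)))\<^sup>2) \<partial>M)"

text \<open>
  Two consecutive iterates share their outermost map, and conditionally on the rest this map contracts
  their difference by \<open>q\<close> in mean square.
\<close>
lemma backward_step_moment:
  "(\<integral>\<^sup>+\<omega>. ennreal ((norm (backward (Suc k) \<omega> - backward k \<omega>))\<^sup>2) \<partial>sequences)
    \<le> ennreal (q ^ (2 * k)) * moment0"
proof (induction k)
  case 0
  interpret S: prob_space sequences by (rule prob_space_sequences)
  have "(\<integral>\<^sup>+\<omega>. ennreal ((norm (backward (Suc 0) \<omega> - backward 0 \<omega>))\<^sup>2) \<partial>sequences) = moment0"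
    by (subst nn_integral_sequences) (simp_all add: moment0_def S.emeasure_space_1)
  then show ?case by simp
next
  case (Suc k)
  have "(\<integral>\<^sup>+\<omega>. ennreal ((norm (backward (Suc (Suc k)) \<omega> - backward (Suc k) \<omega>))\<^sup>2) \<partial>sequences)
     = (\<integral>\<^sup>+\<omega>. \<integral>\<^sup>+s. ennreal ((norm (\<phi> (backward (Suc k) \<omega>, s) - \<phi> (backward k \<omega>, s)))\<^sup>2) \<partial>M \<partial>sequences)"
    by (subst nn_integral_sequences, measurable)
  also have "\<dots> \<le> (\<integral>\<^sup>+\<omega>. ennreal (q\<^sup>2) * ennreal ((norm (backward (Suc k) \<omega> - backward k \<omega>))\<^sup>2) \<partial>sequences)"
  proof (rule nn_integral_mono)
    fix \<omega>
    have "(\<integral>\<^sup>+s. ennreal ((norm (\<phi> (backward (Suc k) \<omega>, s) - \<phi> (backward k \<omega>, s)))\<^sup>2) \<partial>M)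
        \<le> (\<integral>\<^sup>+s. ennreal ((q * norm (backward (Suc k) \<omega> - backward k \<omega>))\<^sup>2) \<partial>M)"
      using map_lipschitz[of "backward (Suc k) \<omega>" "backward k \<omega>"]
      by (intro nn_integral_mono_AE) (auto elim!: eventually_mono intro!: ennreal_leI power_mono)
    then show "(\<integral>\<^sup>+s. ennreal ((norm (\<phi> (backward (Suc k) \<omega>, s) - \<phi> (backward k \<omega>, s)))\<^sup>2) \<partial>M)
        \<le> ennreal (q\<^sup>2) * ennreal ((norm (backward (Suc k) \<omega> - backward k \<omega>))\<^sup>2)"
      by (simp add: emeasure_space_1 power_mult_distrib ennreal_mult)
  qed
  also have "\<dots> = ennreal (q\<^sup>2) * (\<integral>\<^sup>+\<omega>. ennreal ((norm (backward (Suc k) \<omega> - backward k \<omega>))\<^sup>2) \<partial>sequences)"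
    by (rule nn_integral_cmult) measurable
  also have "\<dots> \<le> ennreal (q\<^sup>2) * (ennreal (q ^ (2 * k)) * moment0)"
    by (rule mult_left_mono[OF Suc]) simp
  also have "\<dots> = ennreal (q ^ (2 * Suc k)) * moment0"
    using q_nonneg by (simp add: power_add power2_eq_square mult_ac flip: ennreal_mult)
  finally show ?case .
qed

text \<open>
  The weights \<open>q\<^sup>-\<^sup>k\<close> split the decay \<open>q\<^sup>2\<^sup>k\<close> of the mean squares in two: the expectation of the energy is
  still a convergent geometric series, while a finite energy bounds the \<open>k\<close>-th step by a multiple
  of \<open>(sqrt q) ^ k\<close>. A single integrable variable thus controls both the convergence of the iterates
  and the second moment of their limit.
\<close>
definition step_energy :: "(nat \<Rightarrow> 'w) \<Rightarrow> ennreal" where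
  "step_energy \<omega> = (\<Sum>k. ennreal ((norm (backward (Suc k) \<omega> - backward k \<omega>))\<^sup>2 / q ^ k))"

lemma step_energy_measurable [measurable]: "step_energy \<in> borel_measurable sequences"
  unfolding step_energy_def[abs_def] by measurable

lemma step_energy_integrable:
  assumes q: "0 < q" "q < 1" and fin: "moment0 < \<infinity>"
  shows "(\<integral>\<^sup>+\<omega>. step_energy \<omega> \<partial>sequences) < \<infinity>"
proof -
  have "(\<integral>\<^sup>+\<omega>. step_energy \<omega> \<partial>sequences) = (\<Sum>k. \<integral>\<^sup>+\<omega>. ennreal ((norm (backward (Suc k) \<omega> - backward k \<omega>))\<^sup>2 / q ^ k) \<partial>sequences)"
    unfolding step_energy_def by (rule nn_integral_suminf) measurable
  also have "\<dots> \<le> (\<Sum>k. ennreal (q ^ k) * moment0)"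
  proof (intro suminf_le)
    fix k
    have "(\<integral>\<^sup>+\<omega>. ennreal ((norm (backward (Suc k) \<omega> - backward k \<omega>))\<^sup>2 / q ^ k) \<partial>sequences)
      = (\<integral>\<^sup>+\<omega>. ennreal (1 / q ^ k) * ennreal ((norm (backward (Suc k) \<omega> - backward k \<omega>))\<^sup>2) \<partial>sequences)"
      using q by (simp flip: ennreal_mult)
    also have "\<dots> = ennreal (1 / q ^ k) * (\<integral>\<^sup>+\<omega>. ennreal ((norm (backward (Suc k) \<omega> - backward k \<omega>))\<^sup>2) \<partial>sequences)"
      by (rule nn_integral_cmult) measurable
    also have "\<dots> \<le> ennreal (1 / q ^ k) * (ennreal (q ^ (2 * k)) * moment0)"
      by (rule mult_left_mono[OF backward_step_moment]) simp
    also have "\<dots> = ennreal (1 / q ^ k * q ^ (2 * k)) * moment0"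
      by (subst ennreal_mult) (use q in \<open>auto simp: mult.assoc\<close>)
    also have "1 / q ^ k * q ^ (2 * k) = q ^ k"
      using q by (simp add: mult_2 power_add)
    finally show "(\<integral>\<^sup>+\<omega>. ennreal ((norm (backward (Suc k) \<omega> - backward k \<omega>))\<^sup>2 / q ^ k) \<partial>sequences)
      \<le> ennreal (q ^ k) * moment0" .
  qed auto
  also have "\<dots> = (\<Sum>k. ennreal (q ^ k)) * moment0"
    by (rule ennreal_suminf_multc)
  also have "(\<Sum>k. ennreal (q ^ k)) = ennreal (\<Sum>k. q ^ k)"
    using q by (intro suminf_ennreal2 summable_geometric) auto
  also have "ennreal (\<Sum>k. q ^ k) * moment0 < \<infinity>"
    using fin by (simp add: ennreal_mult_less_top)
  finally show ?thesis .
qed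

definition backward_limit :: "(nat \<Rightarrow> 'w) \<Rightarrow> 'b" where
  "backward_limit \<omega> = lim (\<lambda>k. backward k \<omega>)"

lemma backward_limit_measurable [measurable]: "backward_limit \<in> borel_measurable sequences"
  unfolding backward_limit_def[abs_def] by (rule borel_measurable_lim_metric) measurable

lemma backward_tendsto:
  assumes q: "0 < q" "q < 1" and fin: "step_energy \<omega> < \<infinity>"
  shows "(\<lambda>k. backward k \<omega>) \<longlonglongrightarrow> backward_limit \<omega>"
    and "ennreal ((norm (backward_limit \<omega>))\<^sup>2) \<le> ennreal (1 / (1 - sqrt q)\<^sup>2) * step_energy \<omega>"
proof -
  obtain r where r: "0 \<le> r" "step_energy \<omega> = ennreal r"
    using fin by (cases "step_energy \<omega>") auto
  have step: "norm (backward (Suc k) \<omega> - backward k \<omega>) \<le> sqrt r * sqrt q ^ k" for k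
  proof -
    have "ennreal ((norm (backward (Suc k) \<omega> - backward k \<omega>))\<^sup>2 / q ^ k) \<le> step_energy \<omega>"
      unfolding step_energy_def
      using sum_le_suminf[OF summableI, of "{k}"
        "\<lambda>k. ennreal ((norm (backward (Suc k) \<omega> - backward k \<omega>))\<^sup>2 / q ^ k)"] by simp
    then have "(norm (backward (Suc k) \<omega> - backward k \<omega>))\<^sup>2 \<le> r * q ^ k"
      unfolding r(2) using r(1) q by (simp add: field_simps)
    then have "norm (backward (Suc k) \<omega> - backward k \<omega>) \<le> sqrt (r * q ^ k)"
      by (rule real_le_rsqrt)
    then show ?thesis by (simp add: real_sqrt_mult real_sqrt_power)
  qed
  have sq: "0 < sqrt q" "sqrt q < 1" using q by simp_all
  note conv = geometric_step_convergence[of "sqrt q" "\<lambda>k. backward k \<omega>", OF sq step]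
  show "(\<lambda>k. backward k \<omega>) \<longlonglongrightarrow> backward_limit \<omega>"
    unfolding backward_limit_def using conv(1) by (simp add: convergent_LIMSEQ_iff)
  have "norm (backward_limit \<omega>) \<le> sqrt r / (1 - sqrt q)"
    using conv(2) by (simp add: backward_limit_def)
  then have "(norm (backward_limit \<omega>))\<^sup>2 \<le> (sqrt r / (1 - sqrt q))\<^sup>2"
    by (rule power_mono) simp
  also have "\<dots> = 1 / (1 - sqrt q)\<^sup>2 * r"
    using r(1) by (simp add: power_divide)
  finally show "ennreal ((norm (backward_limit \<omega>))\<^sup>2) \<le> ennreal (1 / (1 - sqrt q)\<^sup>2) * step_energy \<omega>"
    unfolding r(2) using r(1) by (simp add: ennreal_leI flip: ennreal_mult)
qed

text \<open>
  The law of the limit of the backward iterates is invariant, because applying the operator to a test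
  function shifts \<open>k\<close> to \<open>k + 1\<close> (\<open>integral_backward_Suc\<close>) and both sides have the same limit.
\<close>
lemma fixed_point_exists:
  assumes q: "0 < q" "q < 1" and fin: "(\<integral>\<^sup>+\<omega>. ennreal ((norm (\<phi> (0, \<omega>)))\<^sup>2) \<partial>M) < \<infinity>"
  shows "\<exists>\<mu>. sets \<mu> = sets borel \<and> prob_space \<mu> \<and> (\<integral>\<^sup>+x. ennreal ((norm x)\<^sup>2) \<partial>\<mu>) < \<infinity> \<and> push \<mu> = \<mu>"
proof -
  interpret S: prob_space sequences by (rule prob_space_sequences)
  define \<mu> where "\<mu> = distr sequences borel backward_limit"
  have E: "(\<integral>\<^sup>+\<omega>. step_energy \<omega> \<partial>sequences) < \<infinity>"
    using q fin by (intro step_energy_integrable) (auto simp: moment0_def)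
  then have "AE \<omega> in sequences. step_energy \<omega> \<noteq> \<infinity>"
    by (intro nn_integral_noteq_infinite) auto
  then have ae: "AE \<omega> in sequences. step_energy \<omega> < \<infinity>"
    by eventually_elim (simp add: less_top)
  have sets: "sets \<mu> = sets borel" by (simp add: \<mu>_def)
  have prob: "prob_space \<mu>" unfolding \<mu>_def by (rule S.prob_space_distr) measurable
  have "(\<integral>\<^sup>+x. ennreal ((norm x)\<^sup>2) \<partial>\<mu>) = (\<integral>\<^sup>+\<omega>. ennreal ((norm (backward_limit \<omega>))\<^sup>2) \<partial>sequences)"
    unfolding \<mu>_def by (subst nn_integral_distr) auto
  also have "\<dots> \<le> (\<integral>\<^sup>+\<omega>. ennreal (1 / (1 - sqrt q)\<^sup>2) * step_energy \<omega> \<partial>sequences)"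
    using ae by (intro nn_integral_mono_AE) (auto elim!: eventually_mono intro: backward_tendsto(2)[OF q])
  also have "\<dots> = ennreal (1 / (1 - sqrt q)\<^sup>2) * (\<integral>\<^sup>+\<omega>. step_energy \<omega> \<partial>sequences)"
    by (rule nn_integral_cmult) measurable
  also have "\<dots> < \<infinity>" using E by (simp add: ennreal_mult_less_top)
  finally have moment: "(\<integral>\<^sup>+x. ennreal ((norm x)\<^sup>2) \<partial>\<mu>) < \<infinity>" .
  have limit: "(\<lambda>k. \<integral>\<omega>. f (backward k \<omega>) \<partial>sequences) \<longlonglongrightarrow> (\<integral>x. f x \<partial>\<mu>)" if f: "bounded_lipschitz f" for f
  proof -
    have [measurable]: "f \<in> borel_measurable borel" by (rule bounded_lipschitz_measurable[OF f])
    obtain B where B: "\<And>x. \<bar>f x\<bar> \<le> B" using f by (auto simp: bounded_lipschitz_def)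
    have "(\<lambda>k. \<integral>\<omega>. f (backward k \<omega>) \<partial>sequences) \<longlonglongrightarrow> (\<integral>\<omega>. f (backward_limit \<omega>) \<partial>sequences)"
    proof (rule integral_dominated_convergence[where w="\<lambda>_. B"])
      show "AE \<omega> in sequences. (\<lambda>k. f (backward k \<omega>)) \<longlonglongrightarrow> f (backward_limit \<omega>)"
        using ae by eventually_elim
          (rule isCont_tendsto_compose[OF bounded_lipschitz_isCont[OF f] backward_tendsto(1)[OF q]])
    qed (use B in auto)
    also have "(\<integral>\<omega>. f (backward_limit \<omega>) \<partial>sequences) = (\<integral>x. f x \<partial>\<mu>)"
      unfolding \<mu>_def by (rule integral_distr[symmetric]) measurable
    finally show ?thesis .
  qed
  have "push \<mu> = \<mu>"
  proof (rule measure_eqI_bounded_lipschitz[OF _ push_prob_space[OF prob sets] sets prob])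
    show "sets (push \<mu>) = sets borel" by (simp add: push_def)
    fix f :: "'b \<Rightarrow> real" assume f: "bounded_lipschitz f"
    have "(\<lambda>k. \<integral>\<omega>. f (backward (Suc k) \<omega>) \<partial>sequences) \<longlonglongrightarrow> (\<integral>x. f x \<partial>\<mu>)"
      by (rule LIMSEQ_Suc[OF limit[OF f]])
    then have "(\<lambda>k. \<integral>\<omega>. operator f (backward k \<omega>) \<partial>sequences) \<longlonglongrightarrow> (\<integral>x. f x \<partial>\<mu>)"
      unfolding integral_backward_Suc[OF f] .
    with limit[OF operator_bounded_lipschitz[OF f]]
    have "(\<integral>x. operator f x \<partial>\<mu>) = (\<integral>x. f x \<partial>\<mu>)" by (rule LIMSEQ_unique)
    then show "(\<integral>x. f x \<partial>push \<mu>) = (\<integral>x. f x \<partial>\<mu>)"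
      using integral_push[OF prob sets f] by simp
  qed
  with sets prob moment show ?thesis by blast
qed

end

section \<open>Transporting couplings and kernels\<close>

text \<open>The synchronous coupling: the same \<open>\<omega>\<close> moves both coordinates.\<close>
lemma (in random_lipschitz_map) coupling_push:
  fixes \<nu> \<mu> :: "'b measure"
  assumes \<pi>: "sets \<pi> = sets (borel \<Otimes>\<^sub>M borel)" "distr \<pi> borel fst = \<nu>" "distr \<pi> borel snd = \<mu>"
    and \<nu>: "prob_space \<nu>"
  defines "\<pi>' \<equiv> distr (\<pi> \<Otimes>\<^sub>M M) (borel \<Otimes>\<^sub>M borel) (\<lambda>(z, \<omega>). (\<phi> (fst z, \<omega>), \<phi> (snd z, \<omega>)))"
  shows "distr \<pi>' borel fst = push \<nu>" "distr \<pi>' borel snd = push \<mu>"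
    and "(\<integral>\<^sup>+z. ennreal ((dist (fst z) (snd z))\<^sup>2) \<partial>\<pi>')
      \<le> ennreal (q\<^sup>2) * (\<integral>\<^sup>+z. ennreal ((dist (fst z) (snd z))\<^sup>2) \<partial>\<pi>)"
proof -
  have [measurable_cong]: "sets \<pi> = sets (borel \<Otimes>\<^sub>M borel)" by fact
  have sf: "sigma_finite_measure M" and one: "emeasure M (space M) = 1"
    by (unfold_locales, rule emeasure_space_1)
  have fst_m: "fst \<in> measurable \<pi> borel" and snd_m: "snd \<in> measurable \<pi> borel" by measurable
  have "prob_space \<pi>"
  proof
    have "emeasure \<pi> (space \<pi>) = emeasure \<nu> (space \<nu>)"
      unfolding \<pi>(2)[symmetric] by (subst emeasure_distr[OF fst_m]) auto
    then show "emeasure \<pi> (space \<pi>) = 1" using \<nu> by (simp add: prob_space.emeasure_space_1)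
  qed
  then interpret \<pi>: prob_space \<pi> .
  interpret pair_prob_space \<pi> M ..
  have proj: "distr (\<pi> \<Otimes>\<^sub>M M) borel (\<lambda>(z, \<omega>). \<phi> (p z, \<omega>)) = push (distr \<pi> borel p)"
    if [measurable]: "p \<in> measurable \<pi> borel" for p
  proof -
    have "distr \<pi> borel p \<Otimes>\<^sub>M M = distr \<pi> borel p \<Otimes>\<^sub>M distr M M (\<lambda>\<omega>. \<omega>)"
      by (simp add: distr_id2)
    also have "\<dots> = distr (\<pi> \<Otimes>\<^sub>M M) (borel \<Otimes>\<^sub>M M) (\<lambda>(z, \<omega>). (p z, \<omega>))"
      by (rule pair_measure_distr) (auto simp: distr_id2 sf)
    finally show ?thesis
      unfolding push_def by (simp add: distr_distr comp_def case_prod_beta')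
  qed
  show "distr \<pi>' borel fst = push \<nu>"
    unfolding \<pi>'_def \<pi>(2)[symmetric] proj[OF fst_m, symmetric]
    by (subst distr_distr) (auto simp: comp_def case_prod_beta')
  show "distr \<pi>' borel snd = push \<mu>"
    unfolding \<pi>'_def \<pi>(3)[symmetric] proj[OF snd_m, symmetric]
    by (subst distr_distr) (auto simp: comp_def case_prod_beta')
  have "(\<integral>\<^sup>+z. ennreal ((dist (fst z) (snd z))\<^sup>2) \<partial>\<pi>')
      = (\<integral>\<^sup>+y. ennreal ((dist (\<phi> (fst (fst y), snd y)) (\<phi> (snd (fst y), snd y)))\<^sup>2) \<partial>(\<pi> \<Otimes>\<^sub>M M))"
    unfolding \<pi>'_def by (subst nn_integral_distr) (auto simp: case_prod_beta')
  also have "\<dots> = (\<integral>\<^sup>+z. \<integral>\<^sup>+\<omega>. ennreal ((dist (\<phi> (fst z, \<omega>)) (\<phi> (snd z, \<omega>)))\<^sup>2) \<partial>M \<partial>\<pi>)"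
    by (subst sigma_finite_measure.nn_integral_fst[OF sf, symmetric]) simp_all
  also have "\<dots> \<le> (\<integral>\<^sup>+z. ennreal (q\<^sup>2) * ennreal ((dist (fst z) (snd z))\<^sup>2) \<partial>\<pi>)"
  proof (rule nn_integral_mono)
    fix z
    have "(\<integral>\<^sup>+\<omega>. ennreal ((dist (\<phi> (fst z, \<omega>)) (\<phi> (snd z, \<omega>)))\<^sup>2) \<partial>M)
        \<le> (\<integral>\<^sup>+\<omega>. ennreal ((q * dist (fst z) (snd z))\<^sup>2) \<partial>M)"
      using map_lipschitz[of "fst z" "snd z"]
      by (intro nn_integral_mono_AE) (auto simp: dist_norm elim!: eventually_mono intro!: ennreal_leI power_mono)
    then show "(\<integral>\<^sup>+\<omega>. ennreal ((dist (\<phi> (fst z, \<omega>)) (\<phi> (snd z, \<omega>)))\<^sup>2) \<partial>M)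
        \<le> ennreal (q\<^sup>2) * ennreal ((dist (fst z) (snd z))\<^sup>2)"
      by (simp add: one power_mult_distrib ennreal_mult)
  qed
  also have "\<dots> = ennreal (q\<^sup>2) * (\<integral>\<^sup>+z. ennreal ((dist (fst z) (snd z))\<^sup>2) \<partial>\<pi>)"
    by (rule nn_integral_cmult) measurable
  finally show "(\<integral>\<^sup>+z. ennreal ((dist (fst z) (snd z))\<^sup>2) \<partial>\<pi>')
      \<le> ennreal (q\<^sup>2) * (\<integral>\<^sup>+z. ennreal ((dist (fst z) (snd z))\<^sup>2) \<partial>\<pi>)" .
qed

text \<open>
  Dividing by \<open>q\<^sup>2\<close> turns the bound for each coupling into a lower bound of the transport costs, so that
  it passes to the infimum even where the costs are infinite.
\<close>
lemma W2_squared_push: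
  fixes \<phi> :: "(real ^ 'n) \<times> 'w \<Rightarrow> real ^ 'n"
  assumes "random_lipschitz_map M \<phi> q" "0 < q" "prob_space \<nu>"
  shows "W2_squared (random_lipschitz_map.push M \<phi> \<nu>) (random_lipschitz_map.push M \<phi> \<mu>)
    \<le> ennreal (q\<^sup>2) * W2_squared \<nu> \<mu>"
proof -
  interpret random_lipschitz_map M \<phi> q by fact
  let ?cost = "\<lambda>\<pi>. \<integral>\<^sup>+z. ennreal ((dist (fst z) (snd z))\<^sup>2) \<partial>\<pi>"
  have "W2_squared (push \<nu>) (push \<mu>) \<le> ennreal (q\<^sup>2) * ?cost \<pi>" if "\<pi> \<in> couplings \<nu> \<mu>" for \<pi>
  proof -
    have \<pi>: "sets \<pi> = sets (borel \<Otimes>\<^sub>M borel)" "distr \<pi> borel fst = \<nu>" "distr \<pi> borel snd = \<mu>"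
      using that by (auto simp: couplings_def)
    note c = coupling_push[OF \<pi> assms(3)]
    have "W2_squared (push \<nu>) (push \<mu>)
      \<le> ?cost (distr (\<pi> \<Otimes>\<^sub>M M) (borel \<Otimes>\<^sub>M borel) (\<lambda>(z, \<omega>). (\<phi> (fst z, \<omega>), \<phi> (snd z, \<omega>))))"
      unfolding W2_squared_def by (rule INF_lower) (simp add: couplings_def c(1,2))
    also note c(3)
    finally show ?thesis .
  qed
  then have "ennreal (1 / q\<^sup>2) * W2_squared (push \<nu>) (push \<mu>) \<le> ?cost \<pi>" if "\<pi> \<in> couplings \<nu> \<mu>" for \<pi>
  proof -
    assume *: "\<And>\<pi>. \<pi> \<in> couplings \<nu> \<mu> \<Longrightarrow> W2_squared (push \<nu>) (push \<mu>) \<le> ennreal (q\<^sup>2) * ?cost \<pi>"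
    have "ennreal (1 / q\<^sup>2) * W2_squared (push \<nu>) (push \<mu>) \<le> ennreal (1 / q\<^sup>2) * (ennreal (q\<^sup>2) * ?cost \<pi>)"
      by (rule mult_left_mono[OF *[OF that]]) simp
    also have "\<dots> = ?cost \<pi>"
      using assms(2) by (simp flip: mult.assoc ennreal_mult)
    finally show ?thesis .
  qed
  then have "ennreal (1 / q\<^sup>2) * W2_squared (push \<nu>) (push \<mu>) \<le> W2_squared \<nu> \<mu>"
    unfolding W2_squared_def[of \<nu> \<mu>] by (rule INF_greatest)
  then have "ennreal (q\<^sup>2) * (ennreal (1 / q\<^sup>2) * W2_squared (push \<nu>) (push \<mu>)) \<le> ennreal (q\<^sup>2) * W2_squared \<nu> \<mu>"
    by (rule mult_left_mono) simp
  then show ?thesis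
    using assms(2) by (simp flip: mult.assoc ennreal_mult)
qed

lemma (in random_lipschitz_map) kernel_measurable:
  "(\<lambda>x. distr M borel (\<lambda>\<omega>. \<phi> (x, \<omega>))) \<in> measurable borel (subprob_algebra borel)"
proof (rule measurable_distr2[where M=M])
  show "(\<lambda>_. M) \<in> borel \<rightarrow>\<^sub>M subprob_algebra M"
    by (rule measurable_const) (simp add: space_subprob_algebra subprob_space_axioms)
qed (simp add: map_measurable)

lemma (in random_lipschitz_map) push_eq_bind:
  assumes \<nu>: "prob_space \<nu>" "sets \<nu> = sets borel"
  shows "\<nu> \<bind> (\<lambda>x. distr M borel (\<lambda>\<omega>. \<phi> (x, \<omega>))) = push \<nu>"
proof -
  have sf: "sigma_finite_measure M" by unfold_locales
  interpret \<nu>: prob_space \<nu> by fact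
  interpret pair_prob_space \<nu> M ..
  have [measurable_cong]: "sets \<nu> = sets borel" by fact
  have K: "(\<lambda>x. distr M borel (\<lambda>\<omega>. \<phi> (x, \<omega>))) \<in> measurable \<nu> (subprob_algebra borel)"
    using kernel_measurable by (simp cong: measurable_cong_sets add: \<nu>(2))
  have ne: "space \<nu> \<noteq> {}" by (rule \<nu>.not_empty)
  show ?thesis
  proof (rule measure_eqI)
    show "sets (\<nu> \<bind> (\<lambda>x. distr M borel (\<lambda>\<omega>. \<phi> (x, \<omega>)))) = sets (push \<nu>)"
      using ne by (subst sets_bind[where N=borel]) (auto simp: push_def)
    fix A assume "A \<in> sets (\<nu> \<bind> (\<lambda>x. distr M borel (\<lambda>\<omega>. \<phi> (x, \<omega>))))"
    then have A [measurable]: "A \<in> sets borel"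
      using ne by (subst (asm) sets_bind[where N=borel]) auto
    have "emeasure (\<nu> \<bind> (\<lambda>x. distr M borel (\<lambda>\<omega>. \<phi> (x, \<omega>)))) A
        = (\<integral>\<^sup>+x. emeasure (distr M borel (\<lambda>\<omega>. \<phi> (x, \<omega>))) A \<partial>\<nu>)"
      by (rule emeasure_bind[OF ne K A])
    also have "\<dots> = (\<integral>\<^sup>+x. emeasure M (Pair x -` (\<phi> -` A \<inter> space (\<nu> \<Otimes>\<^sub>M M))) \<partial>\<nu>)"
    proof (rule nn_integral_cong)
      fix x assume "x \<in> space \<nu>"
      then have "(\<lambda>\<omega>. \<phi> (x, \<omega>)) -` A \<inter> space M = Pair x -` (\<phi> -` A \<inter> space (\<nu> \<Otimes>\<^sub>M M))"
        by (auto simp: space_pair_measure)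
      then show "emeasure (distr M borel (\<lambda>\<omega>. \<phi> (x, \<omega>))) A
          = emeasure M (Pair x -` (\<phi> -` A \<inter> space (\<nu> \<Otimes>\<^sub>M M)))"
        by (simp add: emeasure_distr)
    qed
    also have "\<dots> = emeasure (\<nu> \<Otimes>\<^sub>M M) (\<phi> -` A \<inter> space (\<nu> \<Otimes>\<^sub>M M))"
      by (rule sigma_finite_measure.emeasure_pair_measure_alt[OF sf, symmetric]) measurable
    also have "\<dots> = emeasure (push \<nu>) A"
      unfolding push_def by (rule emeasure_distr[symmetric]) auto
    finally show "emeasure (\<nu> \<bind> (\<lambda>x. distr M borel (\<lambda>\<omega>. \<phi> (x, \<omega>)))) A = emeasure (push \<nu>) A" .
  qed
qed

section \<open>The semigroup of the Levy-driven equation\<close>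

lemma sum_power2_le:
  fixes x z :: real
  shows "(x + z)\<^sup>2 \<le> 2 * x\<^sup>2 + 2 * z\<^sup>2"
  using zero_le_power2[of "x - z"] by (simp add: power2_eq_square algebra_simps)

text \<open>
  Fubini for independent variables. The second variable is replaced by any \<open>B'\<close> with the same law,
  which for increments of a Levy process allows a shift in time.
\<close>
lemma (in prob_space) indep_var_integral:
  fixes F :: "'c \<times> 'c \<Rightarrow> real"
  assumes ind: "indep_var S A T B" and F [measurable]: "F \<in> borel_measurable (S \<Otimes>\<^sub>M T)"
    and bound: "\<And>z. \<bar>F z\<bar> \<le> C"
    and B' [measurable]: "B' \<in> measurable M T" and law: "distr M T B = distr M T B'"
  shows "(\<integral>\<omega>. F (A \<omega>, B \<omega>) \<partial>M) = (\<integral>\<omega>. \<integral>\<omega>'. F (A \<omega>, B' \<omega>') \<partial>M \<partial>M)"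
proof -
  have [measurable]: "A \<in> measurable M S" "B \<in> measurable M T"
    and prod: "distr M S A \<Otimes>\<^sub>M distr M T B = distr M (S \<Otimes>\<^sub>M T) (\<lambda>x. (A x, B x))"
    using ind unfolding indep_var_distribution_eq by auto
  interpret A: prob_space "distr M S A" by (rule prob_space_distr) measurable
  interpret B: prob_space "distr M T B'" by (rule prob_space_distr) measurable
  interpret pair_prob_space "distr M S A" "distr M T B'" ..
  have int: "integrable (distr M S A \<Otimes>\<^sub>M distr M T B') F"
    by (rule P.integrable_const_bound[where B=C]) (use bound in auto)
  have "(\<integral>\<omega>. F (A \<omega>, B \<omega>) \<partial>M) = (\<integral>z. F z \<partial>distr M (S \<Otimes>\<^sub>M T) (\<lambda>x. (A x, B x)))"
    by (rule integral_distr[symmetric]) auto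
  also have "\<dots> = (\<integral>x. \<integral>y. F (x, y) \<partial>distr M T B' \<partial>distr M S A)"
    unfolding prod[symmetric] law by (rule integral_fst'[OF int, symmetric])
  also have "\<dots> = (\<integral>\<omega>. \<integral>y. F (A \<omega>, y) \<partial>distr M T B' \<partial>M)"
    by (rule integral_distr) measurable
  also have "\<dots> = (\<integral>\<omega>. \<integral>\<omega>'. F (A \<omega>, B' \<omega>') \<partial>M \<partial>M)"
    by (intro Bochner_Integration.integral_cong integral_distr) (auto dest: measurable_space[of A])
  finally show ?thesis .
qed

locale levy_langevin = prob_space M for M :: "'w measure" +
  fixes N :: "real \<Rightarrow> 'w \<Rightarrow> real ^ 'n" and g :: "real ^ 'n \<Rightarrow> real ^ 'n"
    and X :: "real ^ 'n \<Rightarrow> real \<Rightarrow> 'w \<Rightarrow> real ^ 'n" and a L :: real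
  assumes levy: "levy_process M N"
    and g_lip: "L-lipschitz_on UNIV g"
    and g_mono: "strongly_monotone a g"
    and a_pos: "0 < a"
    and X_measurable: "\<And>x t. 0 \<le> t \<Longrightarrow> X x t \<in> borel_measurable M"
    and X_solves: "\<And>x. AE \<omega> in M. X x 0 \<omega> = x \<and> path_solution g (\<lambda>t. N t \<omega>) (\<lambda>t. X x t \<omega>)"
begin

lemma N_measurable: "0 \<le> t \<Longrightarrow> N t \<in> borel_measurable M"
  and N_cadlag: "\<omega> \<in> space M \<Longrightarrow> cadlag (\<lambda>t. N t \<omega>)"
  and N_stationary: "0 \<le> s \<Longrightarrow> 0 \<le> h \<Longrightarrow> distr M borel (\<lambda>\<omega>. N (s + h) \<omega> - N s \<omega>)
      = distr M borel (\<lambda>\<omega>. N h \<omega> - N 0 \<omega>)"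
  and N_independent: "0 \<le> \<tau> 0 \<Longrightarrow> (\<And>i. i < k \<Longrightarrow> \<tau> i < \<tau> (Suc i)) \<Longrightarrow>
      indep_vars (\<lambda>_. borel) (\<lambda>i \<omega>. N (\<tau> (Suc i)) \<omega> - N (\<tau> i) \<omega>) {..<k}"
  using levy unfolding levy_process_def by blast+

lemma g_measurable [measurable]: "g \<in> borel_measurable borel"
  by (rule borel_measurable_continuous_onI[OF lipschitz_on_continuous_on[OF g_lip]])

definition scheme :: "real \<Rightarrow> nat \<Rightarrow> real ^ 'n \<Rightarrow> 'w \<Rightarrow> real ^ 'n" where
  "scheme t k x \<omega> = splitting g (\<lambda>_. t / real k) (increments (\<lambda>u. N u \<omega>) (grid 0 (t / real k))) x k"

text \<open>
  A version of \<open>X x t\<close> that is jointly measurable in \<open>(x, \<omega>)\<close>, as a pointwise limit of explicit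
  measurable functions.
\<close>
definition flow :: "real \<Rightarrow> (real ^ 'n) \<times> 'w \<Rightarrow> real ^ 'n" where
  "flow t = (\<lambda>(x, \<omega>). if t = 0 then x else lim (\<lambda>k. scheme t k x \<omega>))"

lemma scheme_tendsto:
  assumes "0 < t"
  shows "AE \<omega> in M. (\<lambda>k. scheme t k x \<omega>) \<longlonglongrightarrow> X x t \<omega>"
  using X_solves[of x] AE_space
proof eventually_elim
  case (elim \<omega>)
  then have "path_solution g (\<lambda>t. N t \<omega>) (\<lambda>t. X x t \<omega>)" "cadlag (\<lambda>t. N t \<omega>)" "(\<lambda>_. x) \<longlonglongrightarrow> X x 0 \<omega>"
    using N_cadlag by auto
  from splitting_tendsto[OF this(1,2) g_lip order_refl assms this(3)]
  show ?case by (simp add: scheme_def)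
qed

lemma flow_eq:
  assumes "0 \<le> t"
  shows "AE \<omega> in M. flow t (x, \<omega>) = X x t \<omega>"
proof (cases "t = 0")
  case True
  show ?thesis using X_solves[of x] by eventually_elim (simp add: flow_def True)
next
  case False
  with assms have "0 < t" by simp
  from scheme_tendsto[OF this, of x] show ?thesis
    by eventually_elim (simp add: flow_def False limI)
qed

lemma scheme_measurable:
  assumes "0 \<le> t"
  shows "(\<lambda>(x, \<omega>). scheme t k x \<omega>) \<in> borel_measurable (borel \<Otimes>\<^sub>M M)"
proof -
  have [measurable]: "N (grid 0 (t / real k) j) \<in> borel_measurable M" for j
    using assms by (intro N_measurable) (simp add: grid_def)
  have "(\<lambda>z. splitting g (\<lambda>_. t / real k) (increments (\<lambda>u. N u (snd z)) (grid 0 (t / real k))) (fst z) j)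
      \<in> borel_measurable (borel \<Otimes>\<^sub>M M)" for j
  proof (induction j)
    case (Suc j)
    note [measurable] = Suc[unfolded increments_def]
    show ?case by (simp add: increments_def)
  qed simp
  then show ?thesis by (simp add: scheme_def case_prod_beta')
qed

lemma flow_measurable: "0 \<le> t \<Longrightarrow> flow t \<in> borel_measurable (borel \<Otimes>\<^sub>M M)"
  using scheme_measurable[of t] unfolding flow_def case_prod_beta' if_distrib
  by (cases "t = 0") (simp_all add: borel_measurable_lim_metric)

lemma flow_random_map:
  assumes "0 \<le> t"
  shows "random_lipschitz_map M (flow t) (exp (- a * t))"
proof
  show "flow t \<in> borel_measurable (borel \<Otimes>\<^sub>M M)" using assms by (rule flow_measurable)
  fix x z
  show "AE \<omega> in M. norm (flow t (x, \<omega>) - flow t (z, \<omega>)) \<le> exp (- a * t) * norm (x - z)"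
    using flow_eq[OF assms, of x] flow_eq[OF assms, of z] X_solves[of x] X_solves[of z] AE_space
  proof eventually_elim
    case (elim \<omega>)
    then have "norm (X x t \<omega> - X z t \<omega>) \<le> exp (- a * t) * norm (X x 0 \<omega> - X z 0 \<omega>)"
      by (intro path_solution_contraction[OF _ _ N_cadlag g_lip g_mono assms]) auto
    with elim show ?case by simp
  qed
qed simp

abbreviation P :: "real \<Rightarrow> (real ^ 'n \<Rightarrow> real) \<Rightarrow> real ^ 'n \<Rightarrow> real" where
  "P t \<equiv> random_lipschitz_map.operator M (flow t)"

abbreviation push_flow :: "real \<Rightarrow> (real ^ 'n) measure \<Rightarrow> (real ^ 'n) measure" where
  "push_flow t \<equiv> random_lipschitz_map.push M (flow t)"

lemma P_eq:
  assumes "0 \<le> t" and f: "bounded_lipschitz f"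
  shows "P t f x = (\<integral>\<omega>. f (X x t \<omega>) \<partial>M)"
proof -
  interpret random_lipschitz_map M "flow t" "exp (- a * t)" by (rule flow_random_map[OF assms(1)])
  have [measurable]: "f \<in> borel_measurable borel" by (rule bounded_lipschitz_measurable[OF f])
  have [measurable]: "X x t \<in> borel_measurable M" by (rule X_measurable[OF assms(1)])
  show ?thesis unfolding operator_def
    using flow_eq[OF assms(1), of x] by (intro integral_cong_AE) (auto elim!: eventually_mono)
qed

text \<open>The Markov operator of one step of the scheme.\<close>
definition step_operator :: "real \<Rightarrow> (real ^ 'n \<Rightarrow> real) \<Rightarrow> real ^ 'n \<Rightarrow> real" where
  "step_operator h f y = (\<integral>\<omega>. f (y + (N h \<omega> - N 0 \<omega>) - h *\<^sub>R g (y + (N h \<omega> - N 0 \<omega>))) \<partial>M)"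

lemma step_operator_measurable:
  assumes [measurable]: "f \<in> borel_measurable borel" and "0 \<le> h"
  shows "step_operator h f \<in> borel_measurable borel"
proof -
  have [measurable]: "N h \<in> borel_measurable M" "N 0 \<in> borel_measurable M"
    using assms by (auto intro: N_measurable)
  show ?thesis unfolding step_operator_def[abs_def] by measurable
qed

lemma step_operator_bound:
  assumes [measurable]: "f \<in> borel_measurable borel" and "0 \<le> h" and B: "\<And>x. \<bar>f x\<bar> \<le> B"
  shows "\<bar>step_operator h f y\<bar> \<le> B"
proof -
  have [measurable]: "N h \<in> borel_measurable M" "N 0 \<in> borel_measurable M"
    using assms by (auto intro: N_measurable)
  have int: "integrable M (\<lambda>\<omega>. f (y + (N h \<omega> - N 0 \<omega>) - h *\<^sub>R g (y + (N h \<omega> - N 0 \<omega>))))"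
    by (rule integrable_const_bound[where B=B]) (use B in auto)
  have "\<bar>step_operator h f y\<bar>
      \<le> (\<integral>\<omega>. \<bar>f (y + (N h \<omega> - N 0 \<omega>) - h *\<^sub>R g (y + (N h \<omega> - N 0 \<omega>)))\<bar> \<partial>M)"
    unfolding step_operator_def by (rule integral_abs_bound)
  also have "\<dots> \<le> (\<integral>\<omega>. B \<partial>M)"
    using int B by (intro integral_mono) auto
  finally show ?thesis by (simp add: prob_space)
qed

lemma step_operator_iterate:
  assumes "f \<in> borel_measurable borel" "0 \<le> h" "\<And>x. \<bar>f x\<bar> \<le> B"
  shows "(step_operator h ^^ i) f \<in> borel_measurable borel \<and> (\<forall>x. \<bar>(step_operator h ^^ i) f x\<bar> \<le> B)"
  using assms by (induction i) (auto intro: step_operator_measurable step_operator_bound)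

text \<open>
  The state after \<open>j\<close> steps is a function of the first \<open>j\<close> increments of the noise, hence independent
  of the next one, which by stationarity is distributed like the increment over \<open>[0, h j]\<close>.
\<close>
lemma integral_splitting_Suc:
  assumes \<tau>: "0 \<le> \<tau> 0" "\<And>i. i \<le> j \<Longrightarrow> \<tau> i < \<tau> (Suc i)"
    and h: "\<And>i. h i = \<tau> (Suc i) - \<tau> i"
    and f [measurable]: "f \<in> borel_measurable borel" and B: "\<And>x. \<bar>f x\<bar> \<le> B"
  shows "(\<integral>\<omega>. f (splitting g h (increments (\<lambda>u. N u \<omega>) \<tau>) x (Suc j)) \<partial>M)
    = (\<integral>\<omega>. step_operator (h j) f (splitting g h (increments (\<lambda>u. N u \<omega>) \<tau>) x j) \<partial>M)"
proof -
  define D where "D i \<omega> = N (\<tau> (Suc i)) \<omega> - N (\<tau> i) \<omega>" for i \<omega>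
  define Y where "Y d = splitting g h d x j" for d
  have \<tau>0: "0 \<le> \<tau> i" if "i \<le> j" for i
    using that
  proof (induction i)
    case (Suc i)
    then show ?case using \<tau>(2)[of i] by simp
  qed (rule \<tau>(1))
  have hj: "0 \<le> h j" using \<tau>(2)[of j] h by simp
  have Y: "Y \<in> borel_measurable (PiM {..<j} (\<lambda>_. borel))"
  proof -
    have "(\<lambda>d. splitting g h d x i) \<in> borel_measurable (PiM {..<j} (\<lambda>_. borel))" if "i \<le> j" for i
      using that
    proof (induction i)
      case (Suc i)
      then have [measurable]: "(\<lambda>d. splitting g h d x i) \<in> borel_measurable (PiM {..<j} (\<lambda>_. borel))"
        by simp
      have [measurable]: "(\<lambda>d. d i) \<in> borel_measurable (PiM {..<j} (\<lambda>_. borel))"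
        using Suc.prems by (intro measurable_component_singleton) auto
      show ?case by simp
    qed simp
    then show ?thesis by (simp add: Y_def[abs_def])
  qed
  have "indep_vars (\<lambda>_. borel) D {..<Suc j}"
    unfolding D_def[abs_def] using \<tau> by (intro N_independent) auto
  from indep_var_restrict[OF this, of "{..<j}" "{j}"]
  have "indep_var (PiM {..<j} (\<lambda>_. borel)) (\<lambda>\<omega>. \<lambda>i\<in>{..<j}. D i \<omega>)
      (PiM {j} (\<lambda>_. borel)) (\<lambda>\<omega>. \<lambda>i\<in>{j}. D i \<omega>)"
    by auto
  from indep_var_compose[OF this Y measurable_component_singleton[of j]]
  have ind: "indep_var borel (\<lambda>\<omega>. Y (\<lambda>i\<in>{..<j}. D i \<omega>)) borel (D j)"
    by (simp add: comp_def)
  have Y_eq: "Y (\<lambda>i\<in>{..<j}. D i \<omega>) = splitting g h (increments (\<lambda>u. N u \<omega>) \<tau>) x j" for \<omega>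
    unfolding Y_def by (rule splitting_cong) (auto simp: D_def increments_def)
  have law: "distr M borel (D j) = distr M borel (\<lambda>\<omega>. N (h j) \<omega> - N 0 \<omega>)"
    using N_stationary[OF \<tau>0[OF order_refl] hj] by (simp add: D_def[abs_def] h)
  have [measurable]: "N (h j) \<in> borel_measurable M" "N 0 \<in> borel_measurable M"
    using hj by (auto intro: N_measurable)
  define F where "F z = f (fst z + snd z - h j *\<^sub>R g (fst z + snd z))" for z
  have "(\<integral>\<omega>. f (splitting g h (increments (\<lambda>u. N u \<omega>) \<tau>) x (Suc j)) \<partial>M)
      = (\<integral>\<omega>. F (Y (\<lambda>i\<in>{..<j}. D i \<omega>), D j \<omega>) \<partial>M)"
    unfolding Y_eq by (simp add: F_def D_def increments_def)
  also have "\<dots> = (\<integral>\<omega>. \<integral>\<omega>'. F (Y (\<lambda>i\<in>{..<j}. D i \<omega>), N (h j) \<omega>' - N 0 \<omega>') \<partial>M \<partial>M)"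
    by (rule indep_var_integral[OF ind _ _ _ law, where C=B]) (simp_all add: F_def[abs_def] B)
  also have "\<dots> = (\<integral>\<omega>. step_operator (h j) f (splitting g h (increments (\<lambda>u. N u \<omega>) \<tau>) x j) \<partial>M)"
    unfolding Y_eq by (simp add: F_def step_operator_def)
  finally show ?thesis .
qed

lemma integral_splitting_uniform:
  assumes \<tau>: "0 \<le> \<tau> 0" "\<And>i. i < m + k \<Longrightarrow> \<tau> i < \<tau> (Suc i)"
    and h: "\<And>i. h i = \<tau> (Suc i) - \<tau> i" and unif: "\<And>i. i < k \<Longrightarrow> h (m + i) = \<eta>" and \<eta>: "0 \<le> \<eta>"
    and f: "f \<in> borel_measurable borel" and B: "\<And>x. \<bar>f x\<bar> \<le> B"
  shows "(\<integral>\<omega>. f (splitting g h (increments (\<lambda>u. N u \<omega>) \<tau>) x (m + k)) \<partial>M)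
    = (\<integral>\<omega>. (step_operator \<eta> ^^ k) f (splitting g h (increments (\<lambda>u. N u \<omega>) \<tau>) x m) \<partial>M)"
  using \<tau>(2) unif f B
proof (induction k arbitrary: f)
  case (Suc k)
  have "(\<integral>\<omega>. f (splitting g h (increments (\<lambda>u. N u \<omega>) \<tau>) x (m + Suc k)) \<partial>M)
    = (\<integral>\<omega>. step_operator \<eta> f (splitting g h (increments (\<lambda>u. N u \<omega>) \<tau>) x (m + k)) \<partial>M)"
    using integral_splitting_Suc[of \<tau> "m + k" h f B x] \<tau>(1) h Suc.prems(2)[of k] Suc.prems by simp
  also have "\<dots> = (\<integral>\<omega>. (step_operator \<eta> ^^ k) (step_operator \<eta> f)
      (splitting g h (increments (\<lambda>u. N u \<omega>) \<tau>) x m) \<partial>M)"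
    using Suc.prems \<eta> by (intro Suc.IH step_operator_measurable step_operator_bound) auto
  finally show ?case by (simp add: funpow_swap1)
qed simp

lemma integral_scheme:
  assumes t: "0 < t" and k: "0 < k" and f: "f \<in> borel_measurable borel" "\<And>x. \<bar>f x\<bar> \<le> B"
  shows "(\<integral>\<omega>. f (scheme t k y \<omega>) \<partial>M) = (step_operator (t / real k) ^^ k) f y"
proof -
  have "(\<integral>\<omega>. f (splitting g (\<lambda>_. t / real k) (increments (\<lambda>u. N u \<omega>) (grid 0 (t / real k))) y (0 + k)) \<partial>M)
    = (\<integral>\<omega>. (step_operator (t / real k) ^^ k) f
        (splitting g (\<lambda>_. t / real k) (increments (\<lambda>u. N u \<omega>) (grid 0 (t / real k))) y 0) \<partial>M)"
    using t k by (intro integral_splitting_uniform[OF _ _ _ _ _ f]) (auto simp: grid_def algebra_simps add_divide_distrib)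
  then show ?thesis by (simp add: scheme_def prob_space)
qed

text \<open>
  Run the scheme with \<open>k\<close> steps of length \<open>s / k\<close> followed by \<open>k\<close> steps of length \<open>t / k\<close>. Pathwise its state
  \<open>E\<close> converges to \<open>X x s\<close> after the first half and to \<open>X x (s + t)\<close> at the end. By independence of the
  increments, the expectation of \<open>f\<close> at the end is that of \<open>G\<close> after the first half, where \<open>G y\<close> is the
  expectation of \<open>f\<close> for the scheme started in \<open>y\<close> and run with \<open>k\<close> steps over time \<open>t\<close>. These functions
  converge pointwise to \<open>P t f\<close>, and their common Lipschitz constant \<open>C * K\<close> makes the convergence
  compatible with that of their arguments.
\<close>
lemma semigroup:
  assumes s: "0 < s" and t: "0 < t" and f: "bounded_lipschitz f"
  shows "P (s + t) f x = P s (P t f) x"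
proof -
  obtain B C where B: "\<And>x. \<bar>f x\<bar> \<le> B" and C: "C-lipschitz_on UNIV f"
    using f by (rule bounded_lipschitzE) blast
  have [measurable]: "f \<in> borel_measurable borel" by (rule bounded_lipschitz_measurable[OF f])
  have C0: "0 \<le> C" using C by (rule lipschitz_on_nonneg)
  have XM: "X y u \<in> borel_measurable M" if "0 \<le> u" for y u using that by (rule X_measurable)
  \<comment> \<open>The time points: \<open>k\<close> cells on \<open>[0, s]\<close>, then cells of length \<open>t / k\<close>.\<close>
  define \<tau> where "\<tau> k j = (if j \<le> k then real j * (s / real k) else s + (real j - real k) * (t / real k))" for k j
  define h where "h k j = \<tau> k (Suc j) - \<tau> k j" for k j
  define E where "E k j \<omega> = splitting g (h k) (increments (\<lambda>u. N u \<omega>) (\<tau> k)) x j" for k j \<omega>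
  define G where "G k = (step_operator (t / real k) ^^ k) f" for k
  define K where "K = exp (L\<^sup>2 * t\<^sup>2 / 2)"

  have h1: "h k j = s / real k" if "j < k" for k j
    using that by (simp add: h_def \<tau>_def algebra_simps add_divide_distrib)
  have h2: "h k (k + j) = t / real k" if "0 < k" for k j
    using that by (cases "j = 0") (simp_all add: h_def \<tau>_def field_simps)
  have \<tau>_mono: "\<tau> k i < \<tau> k (Suc i)" if "0 < k" for k i
  proof -
    have "0 < h k i"
      using h1[of i k] h2[OF that, of "i - k"] s t that by (cases "i < k") auto
    then show ?thesis by (simp add: h_def)
  qed
  have E1: "E k k \<omega> = scheme s k x \<omega>" for k \<omega>
    unfolding E_def scheme_def using h1
    by (intro splitting_cong) (auto simp: increments_def \<tau>_def grid_def)
  have E2: "E k (k + k) \<omega> = splitting g (\<lambda>_. t / real k)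
      (increments (\<lambda>u. N u \<omega>) (grid s (t / real k))) (E k k \<omega>) k" if "0 < k" for k \<omega>
  proof -
    have "\<tau> k (k + j) = grid s (t / real k) j" for j
      using that by (cases "j = 0") (simp_all add: \<tau>_def grid_def)
    from this[of "Suc _"] this show ?thesis
      unfolding E_def splitting_add[of _ _ _ _ k k] using h2[OF that]
      by (intro splitting_cong) (simp_all add: increments_def)
  qed
  have E_meas: "E k j \<in> borel_measurable M" if "0 < k" for k j
  proof (induction j)
    case (Suc j)
    have \<tau>0: "0 \<le> \<tau> k i" for i
      using s t by (simp add: \<tau>_def)
    have [measurable]: "N (\<tau> k (Suc j)) \<in> borel_measurable M" "N (\<tau> k j) \<in> borel_measurable M"
      by (intro N_measurable \<tau>0)+
    note [measurable] = Suc[unfolded E_def[abs_def]]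
    show ?case by (simp add: E_def[abs_def] increments_def)
  qed (simp add: E_def[abs_def])
  have G_meas: "G k \<in> borel_measurable borel" and G_bound: "\<bar>G k y\<bar> \<le> B" for k y
    using step_operator_iterate[of f "t / real k" B k] t B by (simp_all add: G_def)
  have G_scheme: "G k y = (\<integral>\<omega>. f (scheme t k y \<omega>) \<partial>M)" if "0 < k" for k y
    unfolding G_def by (rule integral_scheme[OF t that _ B, symmetric]) measurable
  have scheme_M [measurable]: "scheme t k y \<in> borel_measurable M" for k y
    using measurable_compose[OF _ scheme_measurable[of t k], of "\<lambda>\<omega>. (y, \<omega>)" M] t by simp
  have G_lip: "\<bar>G k y - G k z\<bar> \<le> C * K * norm (y - z)" if k: "0 < k" for k y z
  proof -
    have int: "integrable M (\<lambda>\<omega>. f (scheme t k y \<omega>))" for y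
      by (rule integrable_const_bound[where B=B]) (use B in auto)
    have "\<bar>G k y - G k z\<bar> = \<bar>\<integral>\<omega>. f (scheme t k y \<omega>) - f (scheme t k z \<omega>) \<partial>M\<bar>"
      unfolding G_scheme[OF k] using int by simp
    also have "\<dots> \<le> (\<integral>\<omega>. \<bar>f (scheme t k y \<omega>) - f (scheme t k z \<omega>)\<bar> \<partial>M)"
      by (rule integral_abs_bound)
    also have "\<dots> \<le> (\<integral>\<omega>. C * K * norm (y - z) \<partial>M)"
    proof (rule integral_mono)
      fix \<omega>
      have "norm (scheme t k y \<omega> - scheme t k z \<omega>) \<le> exp (- a * t + L\<^sup>2 * t\<^sup>2 / (2 * real k)) * norm (y - z)"
        unfolding scheme_def by (rule splitting_contraction_grid[OF g_lip g_mono t k])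
      moreover have "\<bar>f (scheme t k y \<omega>) - f (scheme t k z \<omega>)\<bar> \<le> C * norm (scheme t k y \<omega> - scheme t k z \<omega>)"
        using lipschitz_onD[OF C, of "scheme t k y \<omega>" "scheme t k z \<omega>"] by (simp add: dist_norm)
      moreover have "exp (- a * t + L\<^sup>2 * t\<^sup>2 / (2 * real k)) \<le> K"
      proof -
        have "L\<^sup>2 * t\<^sup>2 / (2 * real k) \<le> L\<^sup>2 * t\<^sup>2 / 2"
          using k by (intro divide_left_mono) auto
        moreover have "0 \<le> a * t" using a_pos t by simp
        ultimately show ?thesis by (simp add: K_def)
      qed
      ultimately show "\<bar>f (scheme t k y \<omega>) - f (scheme t k z \<omega>)\<bar> \<le> C * K * norm (y - z)"
        using mult_left_mono[OF _ C0, of "norm (scheme t k y \<omega> - scheme t k z \<omega>)" "K * norm (y - z)"]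
          mult_right_mono[of _ K "norm (y - z)"] by (fastforce simp: mult.assoc)
    qed (use int in auto)
    finally show ?thesis by (simp add: prob_space)
  qed
  have G_lim: "(\<lambda>k. G (Suc k) y) \<longlonglongrightarrow> P t f y" for y
    unfolding G_scheme[OF zero_less_Suc] P_eq[OF less_imp_le[OF t] f]
  proof (rule integral_dominated_convergence[where w="\<lambda>_. B"])
    show "AE \<omega> in M. (\<lambda>k. f (scheme t (Suc k) y \<omega>)) \<longlonglongrightarrow> f (X y t \<omega>)"
      using scheme_tendsto[OF t, of y]
      by eventually_elim (rule isCont_tendsto_compose[OF bounded_lipschitz_isCont[OF f] LIMSEQ_Suc])
  qed (use B XM t in \<open>auto intro!: measurable_compose[OF XM]\<close>)
  have bl: "bounded_lipschitz (P t f)"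
    by (rule random_lipschitz_map.operator_bounded_lipschitz[OF flow_random_map f]) (use t in simp)
  have eq: "(\<integral>\<omega>. f (E (Suc k) (Suc k + Suc k) \<omega>) \<partial>M) = (\<integral>\<omega>. G (Suc k) (E (Suc k) (Suc k) \<omega>) \<partial>M)" for k
    unfolding E_def G_def
  proof (rule integral_splitting_uniform[OF _ _ _ _ _ _ B])
    show "0 \<le> \<tau> (Suc k) 0" by (simp add: \<tau>_def)
    show "\<tau> (Suc k) i < \<tau> (Suc k) (Suc i)" for i by (rule \<tau>_mono) simp
    show "h (Suc k) i = \<tau> (Suc k) (Suc i) - \<tau> (Suc k) i" for i by (rule h_def)
    show "h (Suc k) (Suc k + i) = t / real (Suc k)" for i by (rule h2) simp
  qed (use t in auto)
  have ae: "AE \<omega> in M. (\<lambda>k. E (Suc k) (Suc k) \<omega>) \<longlonglongrightarrow> X x s \<omega>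
      \<and> (\<lambda>k. E (Suc k) (Suc k + Suc k) \<omega>) \<longlonglongrightarrow> X x (s + t) \<omega>"
    using scheme_tendsto[OF s, of x] X_solves[of x] AE_space
  proof eventually_elim
    case (elim \<omega>)
    have z: "(\<lambda>k. E k k \<omega>) \<longlonglongrightarrow> X x s \<omega>" using elim(1) by (simp add: E1)
    have sol: "path_solution g (\<lambda>t. N t \<omega>) (\<lambda>t. X x t \<omega>)" using elim(2) by simp
    have "(\<lambda>k. splitting g (\<lambda>_. t / real k) (increments (\<lambda>u. N u \<omega>) (grid s (t / real k))) (E k k \<omega>) k)
        \<longlonglongrightarrow> X x (s + t) \<omega>"
      using s by (intro splitting_tendsto[OF sol N_cadlag[OF elim(3)] g_lip _ t z]) simp
    from LIMSEQ_Suc[OF this] LIMSEQ_Suc[OF z] show ?case by (simp only: E2[OF zero_less_Suc])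
  qed
  have "(\<lambda>k. \<integral>\<omega>. f (E (Suc k) (Suc k + Suc k) \<omega>) \<partial>M) \<longlonglongrightarrow> (\<integral>\<omega>. f (X x (s + t) \<omega>) \<partial>M)"
  proof (rule integral_dominated_convergence[where w="\<lambda>_. B"])
    show "AE \<omega> in M. (\<lambda>k. f (E (Suc k) (Suc k + Suc k) \<omega>)) \<longlonglongrightarrow> f (X x (s + t) \<omega>)"
      using ae by eventually_elim (rule isCont_tendsto_compose[OF bounded_lipschitz_isCont[OF f]], simp)
    show "(\<lambda>\<omega>. f (E (Suc k) (Suc k + Suc k) \<omega>)) \<in> borel_measurable M" for k
      by (rule measurable_compose[OF E_meas]) auto
    show "(\<lambda>\<omega>. f (X x (s + t) \<omega>)) \<in> borel_measurable M"
      by (rule measurable_compose[OF XM]) (use s t in auto)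
  qed (use B in auto)
  moreover have "(\<lambda>k. \<integral>\<omega>. G (Suc k) (E (Suc k) (Suc k) \<omega>) \<partial>M) \<longlonglongrightarrow> (\<integral>\<omega>. P t f (X x s \<omega>) \<partial>M)"
  proof (rule integral_dominated_convergence[where w="\<lambda>_. B"])
    show "(\<lambda>\<omega>. G (Suc k) (E (Suc k) (Suc k) \<omega>)) \<in> borel_measurable M" for k
      by (rule measurable_compose[OF E_meas G_meas]) simp
    show "(\<lambda>\<omega>. P t f (X x s \<omega>)) \<in> borel_measurable M"
      by (rule measurable_compose[OF XM bounded_lipschitz_measurable[OF bl]]) (use s in simp)
    show "AE \<omega> in M. (\<lambda>k. G (Suc k) (E (Suc k) (Suc k) \<omega>)) \<longlonglongrightarrow> P t f (X x s \<omega>)"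
      using ae
    proof eventually_elim
      case (elim \<omega>)
      have "(\<lambda>k. C * K * norm (E (Suc k) (Suc k) \<omega> - X x s \<omega>)) \<longlonglongrightarrow> C * K * norm (X x s \<omega> - X x s \<omega>)"
        using elim by (intro tendsto_intros) simp
      then have null: "(\<lambda>k. C * K * norm (E (Suc k) (Suc k) \<omega> - X x s \<omega>)) \<longlonglongrightarrow> 0" by simp
      have "\<forall>\<^sub>F k in sequentially. norm (G (Suc k) (E (Suc k) (Suc k) \<omega>) - G (Suc k) (X x s \<omega>))
          \<le> C * K * norm (E (Suc k) (Suc k) \<omega> - X x s \<omega>)"
        unfolding real_norm_def by (intro always_eventually allI G_lip) simp
      from Lim_null_comparison[OF this null]
      have "(\<lambda>k. G (Suc k) (E (Suc k) (Suc k) \<omega>) - G (Suc k) (X x s \<omega>)) \<longlonglongrightarrow> 0" .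
      from tendsto_add[OF this G_lim[of "X x s \<omega>"]] show ?case by simp
    qed
  qed (use G_bound in auto)
  ultimately have "(\<integral>\<omega>. f (X x (s + t) \<omega>) \<partial>M) = (\<integral>\<omega>. P t f (X x s \<omega>) \<partial>M)"
    unfolding eq by (rule LIMSEQ_unique)
  then show ?thesis
    using s t by (simp add: P_eq[OF _ f] P_eq[OF _ bl])
qed

section \<open>The invariant measure\<close>

text \<open>
  The growth bound is linear in the supremum of the noise. That supremum runs over an uncountable
  set of times; it is compared from below with the measurable variable \<open>excess\<close>, so that additivity
  of the integral is applied to measurable functions only.
\<close>
lemma flow_moment:
  assumes moment: "(\<integral>\<^sup>+\<omega>. (SUP t\<in>{0..1}. ennreal ((norm (N t \<omega>))\<^sup>2)) \<partial>M) < \<infinity>"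
  shows "(\<integral>\<^sup>+\<omega>. ennreal ((norm (flow 1 (0, \<omega>)))\<^sup>2) \<partial>M) < \<infinity>"
proof -
  have [measurable]: "X 0 1 \<in> borel_measurable M" by (rule X_measurable) simp
  define b c where "b = exp L * norm (g 0)" and "c = exp L * L + 1"
  have L: "0 \<le> L" using g_lip by (rule lipschitz_on_nonneg)
  then have bc: "0 \<le> b" "0 < c" by (auto simp: b_def c_def intro: add_nonneg_pos)
  \<comment> \<open>The growth bound reads \<open>norm (X 0 1 \<omega>) \<le> b + c * S\<close>, where \<open>S\<close> bounds the increments of the noise from
    time \<open>0\<close> and is at most twice its supremum; \<open>(b + 2 c \<rho>)\<^sup>2 \<le> 2 b\<^sup>2 + 8 c\<^sup>2 \<rho>\<^sup>2\<close> explains the constants.\<close>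
  define excess where "excess \<omega> = ((norm (X 0 1 \<omega>))\<^sup>2 - 2 * b\<^sup>2) / (8 * c\<^sup>2)" for \<omega>
  have "AE \<omega> in M. ennreal (excess \<omega>) \<le> (SUP t\<in>{0..1}. ennreal ((norm (N t \<omega>))\<^sup>2))"
    using X_solves[of 0] AE_space
  proof eventually_elim
    case (elim \<omega>)
    define \<sigma> where "\<sigma> = (SUP t\<in>{0..1}. ennreal ((norm (N t \<omega>))\<^sup>2))"
    have "ennreal (excess \<omega>) \<le> \<sigma>"
    proof (cases "\<sigma> = \<infinity>")
      case False
      then obtain r where r: "0 \<le> r" "\<sigma> = ennreal r" by (cases \<sigma>) auto
      have Nb: "norm (N u \<omega>) \<le> sqrt r" if "u \<in> {0..1}" for u
      proof -
        have "ennreal ((norm (N u \<omega>))\<^sup>2) \<le> \<sigma>" unfolding \<sigma>_def using that by (rule SUP_upper)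
        then have "(norm (N u \<omega>))\<^sup>2 \<le> r" using r by simp
        then show ?thesis by (rule real_le_rsqrt)
      qed
      have "norm (N u \<omega> - N 0 \<omega>) \<le> 2 * sqrt r" if "u \<in> {0..1}" for u
        using norm_triangle_ineq4[of "N u \<omega>" "N 0 \<omega>"] Nb[OF that] Nb[of 0] by simp
      from path_solution_growth[OF _ N_cadlag[OF elim(2)] g_lip zero_less_one this, of "\<lambda>t. X 0 t \<omega>"]
      have "norm (X 0 1 \<omega>) \<le> b + c * (2 * sqrt r)"
        using elim(1) by (simp add: b_def c_def algebra_simps)
      then have "(norm (X 0 1 \<omega>))\<^sup>2 \<le> (b + c * (2 * sqrt r))\<^sup>2"
        by (rule power_mono) simp
      also have "\<dots> \<le> 2 * b\<^sup>2 + 2 * (c * (2 * sqrt r))\<^sup>2"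
        by (rule sum_power2_le)
      also have "\<dots> = 2 * b\<^sup>2 + 8 * c\<^sup>2 * r"
        using r(1) by (simp add: power_mult_distrib)
      finally have "excess \<omega> \<le> r"
        using bc by (simp add: excess_def divide_le_eq mult_ac)
      then show ?thesis unfolding r(2) by (rule ennreal_leI)
    qed simp
    then show ?case by (simp only: \<sigma>_def)
  qed
  from order.strict_trans1[OF nn_integral_mono_AE[OF this] moment]
  have "(\<integral>\<^sup>+\<omega>. ennreal (excess \<omega>) \<partial>M) < \<infinity>" .
  moreover have "(\<integral>\<^sup>+\<omega>. ennreal ((norm (X 0 1 \<omega>))\<^sup>2) \<partial>M)
      \<le> (\<integral>\<^sup>+\<omega>. ennreal (2 * b\<^sup>2) + ennreal (8 * c\<^sup>2) * ennreal (excess \<omega>) \<partial>M)"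
  proof (rule nn_integral_mono)
    fix \<omega>
    have "(norm (X 0 1 \<omega>))\<^sup>2 = 2 * b\<^sup>2 + 8 * c\<^sup>2 * excess \<omega>"
      using bc by (simp add: excess_def)
    also have "\<dots> \<le> 2 * b\<^sup>2 + 8 * c\<^sup>2 * max 0 (excess \<omega>)"
      by (intro add_left_mono mult_left_mono) auto
    finally have "ennreal ((norm (X 0 1 \<omega>))\<^sup>2) \<le> ennreal (2 * b\<^sup>2 + 8 * c\<^sup>2 * max 0 (excess \<omega>))"
      by (rule ennreal_leI)
    also have "\<dots> = ennreal (2 * b\<^sup>2) + ennreal (8 * c\<^sup>2) * ennreal (max 0 (excess \<omega>))"
      by (simp add: ennreal_plus ennreal_mult)
    also have "ennreal (max 0 (excess \<omega>)) = ennreal (excess \<omega>)"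
      by (simp add: max_def ennreal_neg)
    finally show "ennreal ((norm (X 0 1 \<omega>))\<^sup>2) \<le> ennreal (2 * b\<^sup>2) + ennreal (8 * c\<^sup>2) * ennreal (excess \<omega>)" .
  qed
  moreover have "\<dots> = ennreal (2 * b\<^sup>2) + ennreal (8 * c\<^sup>2) * (\<integral>\<^sup>+\<omega>. ennreal (excess \<omega>) \<partial>M)"
    by (subst nn_integral_add) (auto simp: nn_integral_cmult emeasure_space_1 excess_def[abs_def])
  ultimately have "(\<integral>\<^sup>+\<omega>. ennreal ((norm (X 0 1 \<omega>))\<^sup>2) \<partial>M) < \<infinity>"
    by (auto simp: ennreal_mult_less_top intro: order.strict_trans1)
  also have "(\<integral>\<^sup>+\<omega>. ennreal ((norm (X 0 1 \<omega>))\<^sup>2) \<partial>M) = (\<integral>\<^sup>+\<omega>. ennreal ((norm (flow 1 (0, \<omega>)))\<^sup>2) \<partial>M)"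
    using flow_eq[of 1 0] by (intro nn_integral_cong_AE) (auto elim!: eventually_mono)
  finally show ?thesis .
qed

lemma push_kernel_eq:
  assumes t: "0 \<le> t" and \<nu>: "prob_space \<nu>" "sets \<nu> = sets borel"
  shows "push_kernel M X \<nu> t = push_flow t \<nu>"
proof -
  interpret random_lipschitz_map M "flow t" "exp (- a * t)" by (rule flow_random_map[OF t])
  have "transition_kernel M X t x = distr M borel (\<lambda>\<omega>. flow t (x, \<omega>))" for x
    unfolding transition_kernel_def
    using flow_eq[OF t, of x] X_measurable[OF t, of x]
    by (intro distr_cong_AE) (auto elim!: eventually_mono)
  then show ?thesis
    unfolding push_kernel_def push_eq_bind[OF \<nu>, symmetric] by presburger
qed

lemma push_flow_0:
  assumes \<nu>: "prob_space \<nu>" "sets \<nu> = sets borel"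
  shows "push_flow 0 \<nu> = \<nu>"
proof -
  interpret random_lipschitz_map M "flow 0" "exp (- a * 0)" by (rule flow_random_map) simp
  show ?thesis
  proof (rule measure_eqI_bounded_lipschitz[OF _ push_prob_space[OF \<nu>] \<nu>(2,1)])
    fix f :: "real ^ 'n \<Rightarrow> real" assume f: "bounded_lipschitz f"
    have "operator f x = f x" for x
      unfolding operator_def by (simp add: flow_def prob_space)
    then show "(\<integral>x. f x \<partial>push_flow 0 \<nu>) = (\<integral>x. f x \<partial>\<nu>)"
      unfolding integral_push[OF \<nu> f] by presburger
  qed (simp add: push_def)
qed

text \<open>The dual form of the semigroup property, tested on bounded Lipschitz functions.\<close>
lemma push_flow_add:
  assumes s: "0 < s" and t: "0 < t" and \<nu>: "prob_space \<nu>" "sets \<nu> = sets borel"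
  shows "push_flow t (push_flow s \<nu>) = push_flow (s + t) \<nu>"
proof -
  interpret s: random_lipschitz_map M "flow s" "exp (- a * s)" by (rule flow_random_map) (use s in simp)
  interpret t: random_lipschitz_map M "flow t" "exp (- a * t)" by (rule flow_random_map) (use t in simp)
  interpret st: random_lipschitz_map M "flow (s + t)" "exp (- a * (s + t))"
    by (rule flow_random_map) (use s t in simp)
  have sets: "sets (push_flow u \<rho>) = sets borel" if "0 < u" for u \<rho>
    using random_lipschitz_map.push_def[OF flow_random_map, of u] that by simp
  have ps: "prob_space (push_flow s \<nu>)" by (rule s.push_prob_space[OF \<nu>])
  show ?thesis
  proof (rule measure_eqI_bounded_lipschitz)
    fix f :: "real ^ 'n \<Rightarrow> real" assume f: "bounded_lipschitz f"
    have "(\<integral>x. f x \<partial>push_flow t (push_flow s \<nu>)) = (\<integral>x. P s (P t f) x \<partial>\<nu>)"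
      by (simp add: t.integral_push[OF ps sets[OF s] f]
          s.integral_push[OF \<nu> t.operator_bounded_lipschitz[OF f]])
    also have "\<dots> = (\<integral>x. f x \<partial>push_flow (s + t) \<nu>)"
      unfolding st.integral_push[OF \<nu> f]
      by (rule Bochner_Integration.integral_cong[OF refl]) (rule semigroup[OF s t f, symmetric])
    finally show "(\<integral>x. f x \<partial>push_flow t (push_flow s \<nu>)) = (\<integral>x. f x \<partial>push_flow (s + t) \<nu>)" .
  qed (use s t sets in \<open>auto intro: t.push_prob_space[OF ps] st.push_prob_space[OF \<nu>]\<close>)
qed

text \<open>
  Since the semigroup is commutative, \<open>push_flow t \<mu>\<close> is again invariant at time \<open>1\<close>, and there is only
  one such measure.
\<close>
lemma invariant_of_invariant_1:
  assumes \<mu>: "prob_space \<mu>" "sets \<mu> = sets borel" and inv: "push_flow 1 \<mu> = \<mu>" and t: "0 \<le> t"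
  shows "push_flow t \<mu> = \<mu>"
proof (cases "t = 0")
  case True
  then show ?thesis using push_flow_0[OF \<mu>] by simp
next
  case False
  with t have t: "0 < t" by simp
  interpret t: random_lipschitz_map M "flow t" "exp (- a * t)" by (rule flow_random_map) (use t in simp)
  interpret one: random_lipschitz_map M "flow 1" "exp (- a * 1)" by (rule flow_random_map) simp
  have "push_flow 1 (push_flow t \<mu>) = push_flow t (push_flow 1 \<mu>)"
    using push_flow_add[OF t zero_less_one \<mu>] push_flow_add[OF zero_less_one t \<mu>] by (simp add: add.commute)
  also have "\<dots> = push_flow t \<mu>" by (simp add: inv)
  finally have "push_flow 1 (push_flow t \<mu>) = push_flow t \<mu>" .
  then show ?thesis
    using a_pos by (intro one.fixed_point_unique[OF _ t.push_prob_space[OF \<mu>] _ _ \<mu> inv])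
      (simp_all add: t.push_def)
qed

end

theorem theorem4p9:
  fixes M :: "'w measure"
    and N :: "real \<Rightarrow> 'w \<Rightarrow> real ^ 'n"
    and U :: "real ^ 'n \<Rightarrow> real"
    and X :: "real ^ 'n \<Rightarrow> real \<Rightarrow> 'w \<Rightarrow> real ^ 'n"
    and a :: real
  assumes levy: "levy_process M N"
    and N0: "AE \<omega> in M. N 0 \<omega> = 0"
    and moment: "\<forall>T>0. (\<integral>\<^sup>+\<omega>. (SUP t\<in>{0..T}. ennreal ((norm (N t \<omega>))\<^sup>2)) \<partial>M) < \<infinity>"
    and U_C2: "C2 U"
    and U_Lip: "\<exists>L. L-lipschitz_on UNIV (grad U)"
    and X_sol: "\<forall>x. sde_solution M N U x (X x)"
    and a_pos: "a > 0"
    and convex: "\<forall>x v. v \<bullet> (hessian U x *v v) \<ge> a * (norm v)\<^sup>2"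
  shows "(\<exists>!\<mu>. \<mu> \<in> P2 \<and> (\<forall>t\<ge>0. push_kernel M X \<mu> t = \<mu>)) \<and>
         (\<forall>\<mu>. \<mu> \<in> P2 \<and> (\<forall>t\<ge>0. push_kernel M X \<mu> t = \<mu>) \<longrightarrow>
           (\<forall>t\<ge>0. \<forall>\<nu>\<in>P2. W2_squared (push_kernel M X \<nu> t) \<mu>
              \<le> ennreal (exp (- 2 * a * t)) * W2_squared \<nu> \<mu>))"
proof -
  obtain L where L: "L-lipschitz_on UNIV (grad U)" using U_Lip by blast
  interpret prob_space M using levy by (simp add: levy_process_def)
  interpret levy_langevin M N "grad U" X a L
  proof
    show "strongly_monotone a (grad U)"
      by (rule strongly_monotone_grad[OF U_C2]) (use convex in blast)
    show "X x t \<in> borel_measurable M" if "0 \<le> t" for x t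
      using X_sol that by (auto simp: sde_solution_def)
    show "AE \<omega> in M. X x 0 \<omega> = x \<and> path_solution (grad U) (\<lambda>t. N t \<omega>) (\<lambda>t. X x t \<omega>)" for x
      using X_sol unfolding sde_solution_def path_solution_def by blast
  qed (fact levy L a_pos)+
  interpret one: random_lipschitz_map M "flow 1" "exp (- a * 1)" by (rule flow_random_map) simp
  have P2: "prob_space \<nu>" "sets \<nu> = sets borel" if "\<nu> \<in> P2" for \<nu> :: "(real ^ 'n) measure"
    using that by (auto simp: P2_def)
  obtain \<mu> where \<mu>: "\<mu> \<in> P2" "push_flow 1 \<mu> = \<mu>"
  proof -
    have "\<exists>\<mu>. sets \<mu> = sets borel \<and> prob_space \<mu> \<and> (\<integral>\<^sup>+x. ennreal ((norm x)\<^sup>2) \<partial>\<mu>) < \<infinity>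
        \<and> push_flow 1 \<mu> = \<mu>"
      using a_pos moment by (intro one.fixed_point_exists flow_moment) simp_all
    then show thesis using that unfolding P2_def by blast
  qed
  have inv: "push_kernel M X \<mu> t = \<mu>" if "0 \<le> t" for t
    using push_kernel_eq[OF that P2[OF \<mu>(1)]] invariant_of_invariant_1[OF P2[OF \<mu>(1)] \<mu>(2) that] by simp
  have uniq: "\<nu> = \<mu>" if "\<nu> \<in> P2" "\<forall>t\<ge>0. push_kernel M X \<nu> t = \<nu>" for \<nu>
  proof -
    have "push_flow 1 \<nu> = \<nu>"
      using push_kernel_eq[OF zero_le_one P2[OF that(1)]] that(2) by simp
    from one.fixed_point_unique[OF _ P2[OF that(1)] this P2[OF \<mu>(1)] \<mu>(2)] show ?thesis
      using a_pos by simp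
  qed
  have contract: "W2_squared (push_kernel M X \<nu> t) \<rho> \<le> ennreal (exp (- 2 * a * t)) * W2_squared \<nu> \<rho>"
    if \<rho>: "\<rho> \<in> P2" "\<forall>t\<ge>0. push_kernel M X \<rho> t = \<rho>" and t: "0 \<le> t" and \<nu>: "\<nu> \<in> P2" for \<rho> t \<nu>
  proof -
    have "push_flow t \<rho> = \<rho>" using push_kernel_eq[OF t P2[OF \<rho>(1)]] \<rho>(2) t by simp
    moreover have "(exp (- a * t))\<^sup>2 = exp (- 2 * a * t)"
      by (simp flip: exp_double)
    ultimately show ?thesis
      using W2_squared_push[OF flow_random_map[OF t] _ P2(1)[OF \<nu>], of \<rho>]
        push_kernel_eq[OF t P2[OF \<nu>]] by simp
  qed
  show ?thesis
  proof (intro conjI allI impI ballI)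
    show "\<exists>!\<mu>. \<mu> \<in> P2 \<and> (\<forall>t\<ge>0. push_kernel M X \<mu> t = \<mu>)"
    proof (rule ex1I[of _ \<mu>])
      show "\<mu> \<in> P2 \<and> (\<forall>t\<ge>0. push_kernel M X \<mu> t = \<mu>)"
        by (intro conjI allI impI \<mu>(1) inv)
    qed (elim conjE, rule uniq)
  qed (elim conjE, rule contract)
qed

end
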